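(* Let $\mathcal{H}^3$ be the $3$-uniform hypergraph with vertex set $[N]$ whose edges are the $3$-term arithmetic progressions in $[N]$. Let $p=p_N$ be a sequence which is either a constant in $(0,1/2)$ or converges to $0$ (with $p_N\in(0,1/2)$), and let $\delta_N$ be a sequence satisfying $$\sqrt{\frac{\log N}{pN}}\ \ll\ \delta_N\ \ll\ p^{1/2}.$$ Then $$\mathbb{P}\left(D^{\mathcal{H}^3}(B_p)\ge \delta_N p^3N^2/4\right)=\exp\left(\frac{-(3+o(1))\,\delta_N^2\,pN}{56(1-p)}\right).$$
   Context: $[N]=\{1,\dots,N\}$. Asymptotics are as $N\to\infty$: $a_N\ll b_N$ means $a_N/b_N\to0$, and $o(1)$ denotes a quantity tending to $0$. The edges of $\mathcal{H}^3$ are the sets $\{a,a+d,a+2d\}\subseteq[N]$ with $d\ge1$; $e(\mathcal{H}^3)$ is the number of edges. $B_p\subseteq[N]$ is the random set in which each element of $[N]$ is included independently with probability $p$. $N^{\mathcal{H}^3}(B)$ is the number of edges of $\mathcal{H}^3$ contained in $B$, and $D^{\mathcal{H}^3}(B_p)=N^{\mathcal{H}^3}(B_p)-p^3e(\mathcal{H}^3)$. *)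

theory Defs
  imports "HOL-Probability.Probability"
begin

text \<open>A hypergraph on a fixed vertex set is given by its set of edges.\<close>

definition ap3_hypergraph :: "nat \<Rightarrow> nat set set" where
  "ap3_hypergraph N =
     {{a, a + d, a + 2 * d} | a d. d \<ge> 1 \<and> {a, a + d, a + 2 * d} \<subseteq> {1..N}}"

lemma ap3_hypergraph_uniform: "e \<in> ap3_hypergraph N \<Longrightarrow> card e = 3"
  by (auto simp: ap3_hypergraph_def card_insert_if)

definition edges_within :: "'a set set \<Rightarrow> 'a set \<Rightarrow> nat" where
  "edges_within H B = card {e \<in> H. e \<subseteq> B}"

text \<open>For a \<open>3\<close>-uniform \<open>H\<close> the subtracted term is the expected number of edges in a
  random vertex subset of density \<open>p\<close>.\<close>

definition deviation3 :: "'a set set \<Rightarrow> real \<Rightarrow> 'a set \<Rightarrow> real" where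
  "deviation3 H p B = real (edges_within H B) - p ^ 3 * real (card H)"

definition binomial_subset_pmf :: "nat \<Rightarrow> real \<Rightarrow> nat set pmf" where
  "binomial_subset_pmf N p =
     map_pmf (\<lambda>f. {x \<in> {1..N}. f x}) (Pi_pmf {1..N} False (\<lambda>_. bernoulli_pmf p))"

end

theory Submission
  imports Defs
begin

text \<open>
  Write \<open>y\<^sub>i = 1[i \<in> B] - p\<close>. Expanding the product over each progression gives
  \<open>D = p\<^sup>2 L + R\<close>, where \<open>L = \<Sum> d\<^sub>i y\<^sub>i\<close> (\<open>d\<^sub>i\<close> the number of progressions through \<open>i\<close>) and
  \<open>R = \<Sum> y\<^sub>i W\<^sub>i\<close> with \<open>W\<^sub>i\<close> depending only on \<open>B \<inter> {1..<i}\<close>. The linear part satisfies a Gaussian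
  moderate deviation principle with variance \<open>p (1 - p) \<Sum> d\<^sub>i\<^sup>2 \<sim> (7/12) p (1 - p) N\<^sup>3\<close>, which
  produces the constant \<open>3/56\<close>.

  For the remainder, Freedman's inequality shows that \<open>\<bar>R\<bar> \<ge> \<rho> \<delta> p\<^sup>3 N\<^sup>2\<close> has probability at most
  \<open>exp (- K \<delta>\<^sup>2 p N)\<close> for every \<open>K\<close>, provided that \<open>\<bar>W\<^sub>i\<bar> \<le> \<gamma> p\<^sup>2 N\<close> for all \<open>i\<close> with a small constant \<open>\<gamma>\<close>.
  A second use of Freedman's inequality bounds the probability that this fails by
  \<open>O(N exp (- c \<gamma>\<^sup>2 p\<^sup>2 N))\<close>, which is negligible because \<open>log N \<ll> \<delta>\<^sup>2 p N \<ll> p\<^sup>2 N\<close>.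
\<close>

section \<open>Expectations over the binomial random subset\<close>

abbreviation (input) bexp :: "nat \<Rightarrow> real \<Rightarrow> (nat set \<Rightarrow> real) \<Rightarrow> real" where
  "bexp n p f \<equiv> measure_pmf.expectation (binomial_subset_pmf n p) f"

abbreviation (input) bprob :: "nat \<Rightarrow> real \<Rightarrow> (nat set \<Rightarrow> bool) \<Rightarrow> real" where
  "bprob n p P \<equiv> measure_pmf.prob (binomial_subset_pmf n p) {B. P B}"

definition centered :: "real \<Rightarrow> nat set \<Rightarrow> nat \<Rightarrow> real" where
  "centered p B i = of_bool (i \<in> B) - p"

lemma set_pmf_binomial_subset:
  "B \<in> set_pmf (binomial_subset_pmf n p) \<Longrightarrow> B \<subseteq> {1..n}"
  by (auto simp: binomial_subset_pmf_def)

lemma finite_set_pmf_binomial_subset [simp]: "finite (set_pmf (binomial_subset_pmf n p))"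
  by (rule finite_subset[of _ "Pow {1..n}"]) (use set_pmf_binomial_subset in blast, simp)

text \<open>The largest vertex is an independent coin tossed last. All exponential moments below are
  computed by induction on \<open>n\<close>, integrating out this coin first.\<close>

lemma binomial_subset_pmf_Suc:
  "binomial_subset_pmf (Suc n) p =
     bind_pmf (bernoulli_pmf p)
       (\<lambda>b. map_pmf (\<lambda>B. if b then insert (Suc n) B else B) (binomial_subset_pmf n p))"
proof -
  define S where "S = (\<lambda>f. {x \<in> {1..n}. f x})"
  have *: "{x \<in> {1..Suc n}. (f(Suc n := y)) x} = (if y then insert (Suc n) (S f) else S f)" for f y
    by (auto simp: S_def)
  have ins: "{1..Suc n} = insert (Suc n) {1..n}" by auto
  have "binomial_subset_pmf (Suc n) p =
      map_pmf (\<lambda>f. {x \<in> {1..Suc n}. f x})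
        (map_pmf (\<lambda>(y, f). f(Suc n := y))
          (pair_pmf (bernoulli_pmf p) (Pi_pmf {1..n} False (\<lambda>_. bernoulli_pmf p))))"
    unfolding binomial_subset_pmf_def by (subst (2) ins, subst Pi_pmf_insert) auto
  also have "\<dots> = map_pmf (\<lambda>(y, f). if y then insert (Suc n) (S f) else S f)
        (pair_pmf (bernoulli_pmf p) (Pi_pmf {1..n} False (\<lambda>_. bernoulli_pmf p)))"
    by (simp only: map_pmf_comp case_prod_unfold *)
  also have "\<dots> = bind_pmf (bernoulli_pmf p)
       (\<lambda>b. map_pmf (\<lambda>B. if b then insert (Suc n) B else B)
         (map_pmf S (Pi_pmf {1..n} False (\<lambda>_. bernoulli_pmf p))))"
    by (simp add: pair_pmf_def map_pmf_def bind_return_pmf bind_assoc_pmf)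
  finally show ?thesis by (simp only: S_def binomial_subset_pmf_def)
qed

lemma bexp_Suc:
  assumes "0 \<le> p" "p \<le> 1"
  shows "bexp (Suc n) p f =
    p * bexp n p (\<lambda>B. f (insert (Suc n) B)) + (1 - p) * bexp n p f"
  unfolding binomial_subset_pmf_Suc
  by (subst pmf_expectation_bind[of UNIV]) (use assms in \<open>auto simp: UNIV_bool\<close>)

lemma bexp_0: "bexp 0 p f = f {}"
  by (simp add: binomial_subset_pmf_def)

lemma integrable_binomial_subset [simp]:
  "integrable (measure_pmf (binomial_subset_pmf n p)) (f :: nat set \<Rightarrow> real)"
  by (rule integrable_measure_pmf_finite) simp

lemma bexp_mono:
  assumes "\<And>B. B \<subseteq> {1..n} \<Longrightarrow> f B \<le> g B"
  shows "bexp n p f \<le> bexp n p g"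
  by (rule integral_mono_AE) (auto simp: AE_measure_pmf_iff assms dest!: set_pmf_binomial_subset)

lemma bprob_eq_bexp: "bprob n p P = bexp n p (\<lambda>B. of_bool (P B))"
proof -
  have "(\<lambda>B. of_bool (P B)) = (indicator {B. P B} :: nat set \<Rightarrow> real)"
    by (auto simp: indicator_def)
  then show ?thesis by simp
qed

lemma bprob_mono:
  assumes "\<And>B. B \<subseteq> {1..n} \<Longrightarrow> P B \<Longrightarrow> Q B"
  shows "bprob n p P \<le> bprob n p Q"
  unfolding bprob_eq_bexp by (rule bexp_mono) (use assms in auto)

lemma bprob_disj_le: "bprob n p (\<lambda>B. P B \<or> Q B) \<le> bprob n p P + bprob n p Q"
  unfolding Collect_disj_eq by (rule measure_subadditive) (auto simp: measure_pmf.emeasure_finite)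

lemma bprob_Bex_le:
  assumes "finite I"
  shows "bprob n p (\<lambda>B. \<exists>i\<in>I. P i B) \<le> (\<Sum>i\<in>I. bprob n p (P i))"
proof -
  have "{B. \<exists>i\<in>I. P i B} = (\<Union>i\<in>I. {B. P i B})" by auto
  then show ?thesis
    using measure_pmf.finite_measure_subadditive_finite[OF assms, of "\<lambda>i. {B. P i B}"]
    by simp
qed

section \<open>Exponential moments and Freedman's inequality\<close>

text \<open>Lagrange remainder of order three; its factor \<open>exp t / 6\<close> is at most 3/6
  because \<open>exp 1\<close> is at most 3.\<close>

lemma exp_taylor2:
  fixes x :: real
  assumes "\<bar>x\<bar> \<le> 1"
  shows "\<bar>exp x - (1 + x + x\<^sup>2 / 2)\<bar> \<le> \<bar>x\<bar> * x\<^sup>2 / 2"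
proof -
  obtain t where t: "\<bar>t\<bar> \<le> \<bar>x\<bar>" "exp x = (\<Sum>m<3. x ^ m / fact m) + exp t / fact 3 * x ^ 3"
    using Maclaurin_exp_le[of x 3] by blast
  have "exp t \<le> exp 1" using t assms by (subst exp_le_cancel_iff) linarith
  then have "exp t \<le> 3" using exp_le by linarith
  have "exp x - (1 + x + x\<^sup>2 / 2) = exp t / 6 * x ^ 3"
    unfolding t by (simp add: eval_nat_numeral)
  then have "\<bar>exp x - (1 + x + x\<^sup>2 / 2)\<bar> = exp t / 6 * (\<bar>x\<bar> * x\<^sup>2)"
    by (simp only: abs_mult power3_eq_cube power2_eq_square) (simp add: mult_ac)
  also have "\<dots> \<le> 3 / 6 * (\<bar>x\<bar> * x\<^sup>2)"
    using \<open>exp t \<le> 3\<close> by (intro mult_right_mono) auto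
  finally show ?thesis by simp
qed

text \<open>The moment generating function of a centred Bernoulli variable.\<close>

definition cmgf :: "real \<Rightarrow> real \<Rightarrow> real" where
  "cmgf p u = p * exp ((1 - p) * u) + (1 - p) * exp (- p * u)"

text \<open>The first-order terms cancel since the mean is zero. Keeping the variance
  \<open>p * (1 - p)\<close> as a factor of the error makes the estimate uniform as \<open>p\<close>
  tends to 0.\<close>

lemma cmgf_taylor:
  assumes "0 \<le> p" "p \<le> 1" "\<bar>u\<bar> \<le> 1"
  shows "\<bar>cmgf p u - (1 + p * (1 - p) * u\<^sup>2 / 2)\<bar> \<le> p * (1 - p) * (\<bar>u\<bar> * u\<^sup>2 / 2)"
proof -
  define a b where "a = (1 - p) * u" and "b = - p * u"
  have ab: "\<bar>a\<bar> = (1 - p) * \<bar>u\<bar>" "\<bar>b\<bar> = p * \<bar>u\<bar>"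
    using assms by (auto simp: a_def b_def abs_mult)
  have le1: "\<bar>a\<bar> \<le> 1" "\<bar>b\<bar> \<le> 1"
    unfolding ab using assms mult_mono[of "1-p" 1 "\<bar>u\<bar>" 1] mult_mono[of p 1 "\<bar>u\<bar>" 1] by auto
  have "cmgf p u - (1 + p * (1 - p) * u\<^sup>2 / 2) =
      p * (exp a - (1 + a + a\<^sup>2 / 2)) + (1 - p) * (exp b - (1 + b + b\<^sup>2 / 2))"
    unfolding cmgf_def a_def[symmetric] b_def[symmetric]
    by (simp add: a_def b_def power2_eq_square field_simps)
  also have "\<bar>\<dots>\<bar> \<le> p * \<bar>exp a - (1 + a + a\<^sup>2 / 2)\<bar> + (1 - p) * \<bar>exp b - (1 + b + b\<^sup>2 / 2)\<bar>"
    by (rule order.trans[OF abs_triangle_ineq]) (use assms in \<open>simp add: abs_mult\<close>)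
  also have "\<dots> \<le> p * (\<bar>a\<bar> * a\<^sup>2 / 2) + (1 - p) * (\<bar>b\<bar> * b\<^sup>2 / 2)"
    using assms le1 by (intro add_mono mult_left_mono exp_taylor2) auto
  also have "\<dots> = p * (1 - p) * ((1 - p)\<^sup>2 + p\<^sup>2) * (\<bar>u\<bar> * u\<^sup>2 / 2)"
    unfolding ab by (simp add: a_def b_def power2_eq_square field_simps)
  also have "\<dots> \<le> p * (1 - p) * 1 * (\<bar>u\<bar> * u\<^sup>2 / 2)"
  proof (intro mult_right_mono mult_left_mono)
    have "(1 - p)\<^sup>2 + p\<^sup>2 = 1 - 2 * (p * (1 - p))" by (simp add: power2_eq_square algebra_simps)
    then show "(1 - p)\<^sup>2 + p\<^sup>2 \<le> 1" using assms by simp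
  qed (use assms in auto)
  finally show ?thesis by simp
qed

lemma cmgf_le:
  assumes "0 \<le> p" "p \<le> 1" "\<bar>u\<bar> \<le> \<epsilon>" "\<epsilon> \<le> 1"
  shows "cmgf p u \<le> exp (p * (1 - p) * (1 + \<epsilon>) * u\<^sup>2 / 2)"
proof -
  have "cmgf p u \<le> 1 + p * (1 - p) * u\<^sup>2 / 2 + p * (1 - p) * (\<bar>u\<bar> * u\<^sup>2 / 2)"
    using cmgf_taylor[of p u] assms by linarith
  also have "\<dots> \<le> 1 + p * (1 - p) * u\<^sup>2 / 2 + p * (1 - p) * (\<epsilon> * u\<^sup>2 / 2)"
    using assms by (intro add_left_mono mult_left_mono divide_right_mono mult_right_mono) auto
  also have "\<dots> = 1 + p * (1 - p) * (1 + \<epsilon>) * u\<^sup>2 / 2" by (simp add: field_simps)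
  also have "\<dots> \<le> exp (p * (1 - p) * (1 + \<epsilon>) * u\<^sup>2 / 2)" by (rule exp_ge_add_one_self)
  finally show ?thesis .
qed

text \<open>One factor \<open>1 - \<epsilon>\<close> pays for the Taylor error. A second pays for
  passing from \<open>1 + z\<close> to an exponential, since \<open>ln (1 + z)\<close> is at least
  \<open>z - z^2\<close> and \<open>z \<le> \<epsilon>\<close>. Their product is at least
  \<open>1 - 2 * \<epsilon>\<close>.\<close>

lemma cmgf_ge:
  assumes "0 \<le> p" "p \<le> 1" "\<bar>u\<bar> \<le> \<epsilon>" "\<epsilon> \<le> 1"
  shows "exp (p * (1 - p) * (1 - 2 * \<epsilon>) * u\<^sup>2 / 2) \<le> cmgf p u"
proof -
  define z where "z = p * (1 - p) * (1 - \<epsilon>) * u\<^sup>2 / 2"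
  have \<epsilon>0: "0 \<le> \<epsilon>" using assms by linarith
  have "p * (1 - p) * (1 - \<epsilon>) \<le> 1 * 1 * 1" using assms \<epsilon>0 by (intro mult_mono) auto
  moreover have "u\<^sup>2 \<le> \<epsilon>\<^sup>2" using assms abs_le_square_iff[of u \<epsilon>] by simp
  moreover have "\<epsilon>\<^sup>2 \<le> \<epsilon>" using assms \<epsilon>0 by (simp add: power2_eq_square mult_left_le)
  ultimately have "p * (1 - p) * (1 - \<epsilon>) * u\<^sup>2 \<le> 1 * \<epsilon>"
    using assms by (intro mult_mono) auto
  then have z: "0 \<le> z" "z \<le> \<epsilon>" using assms \<epsilon>0 by (auto simp: z_def)
  have "p * (1 - p) * (1 - 2 * \<epsilon>) * u\<^sup>2 / 2 \<le> (p * (1 - p) * (1 - \<epsilon>) * u\<^sup>2 / 2) * (1 - \<epsilon>)"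
  proof -
    have "(1 - 2 * \<epsilon>) \<le> (1 - \<epsilon>) * (1 - \<epsilon>)" by (simp add: algebra_simps)
    then have "(p * (1 - p) * u\<^sup>2 / 2) * (1 - 2 * \<epsilon>) \<le> (p * (1 - p) * u\<^sup>2 / 2) * ((1 - \<epsilon>) * (1 - \<epsilon>))"
      using assms by (intro mult_left_mono) auto
    then show ?thesis by (simp add: mult_ac)
  qed
  also have "\<dots> \<le> z - z\<^sup>2"
    unfolding z_def[symmetric]
    using z mult_left_mono[of z \<epsilon> z] by (simp add: power2_eq_square algebra_simps)
  also have "\<dots> \<le> ln (1 + z)" using z assms by (intro ln_one_plus_pos_lower_bound) auto
  finally have "exp (p * (1 - p) * (1 - 2 * \<epsilon>) * u\<^sup>2 / 2) \<le> 1 + z"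
    using z by (subst ln_ge_iff[symmetric]) auto
  also have "\<dots> = 1 + p * (1 - p) * u\<^sup>2 / 2 - p * (1 - p) * (\<epsilon> * u\<^sup>2 / 2)"
    by (simp add: z_def field_simps)
  also have "\<dots> \<le> 1 + p * (1 - p) * u\<^sup>2 / 2 - p * (1 - p) * (\<bar>u\<bar> * u\<^sup>2 / 2)"
    using assms by (intro diff_left_mono mult_left_mono divide_right_mono mult_right_mono) auto
  also have "\<dots> \<le> cmgf p u"
    using cmgf_taylor[of p u] assms by linarith
  finally show ?thesis .
qed

text \<open>Predictability for the filtration that reveals the vertices in increasing order, stated
  pointwise so that no sigma-algebras appear.\<close>

definition predictable :: "(nat \<Rightarrow> nat set \<Rightarrow> real) \<Rightarrow> bool" where
  "predictable W \<longleftrightarrow> (\<forall>i B. W i B = W i (B \<inter> {..<i}))"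

lemma predictable_insert:
  assumes "predictable W" "i \<le> k"
  shows "W i (insert k B) = W i B"
proof -
  have "insert k B \<inter> {..<i} = B \<inter> {..<i}" using assms by auto
  then show ?thesis using assms unfolding predictable_def by metis
qed

lemma centered_insert: "i \<noteq> k \<Longrightarrow> centered p (insert k B) i = centered p B i"
  by (simp add: centered_def)

lemma centered_inter: "i < k \<Longrightarrow> centered p (B \<inter> {..<k}) i = centered p B i"
  by (simp add: centered_def)

text \<open>Given the smaller vertices, the coin at \<open>Suc n\<close> contributes the factor
  \<open>cmgf p\<close> of its coefficient, and the compensator cancels it by
  \<open>cmgf_le\<close>. By predictability neither the earlier terms nor that coefficient see the
  coin.\<close>

lemma bexp_exp_supermartingale:
  assumes p: "0 \<le> p" "p \<le> 1" and W: "predictable W"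
    and bd: "\<And>i B. \<bar>W i B\<bar> \<le> \<epsilon>" and \<epsilon>: "\<epsilon> \<le> 1"
  shows "bexp n p (\<lambda>B. exp (\<Sum>i=1..n. centered p B i * W i B
           - p * (1 - p) * (1 + \<epsilon>) / 2 * (W i B)\<^sup>2)) \<le> 1"
proof (induction n)
  case 0
  show ?case by (simp add: bexp_0)
next
  case (Suc n)
  define c where "c = p * (1 - p) * (1 + \<epsilon>) / 2"
  define F where "F = (\<lambda>k B. \<Sum>i=1..k. centered p B i * W i B - c * (W i B)\<^sup>2)"
  have ins: "F n (insert (Suc n) B) = F n B" for B
    unfolding F_def
    by (intro sum.cong refl) (auto simp: centered_insert predictable_insert[OF W])
  have "bexp (Suc n) p (\<lambda>B. exp (F (Suc n) B)) =
      p * bexp n p (\<lambda>B. exp (F (Suc n) (insert (Suc n) B))) + (1 - p) * bexp n p (\<lambda>B. exp (F (Suc n) B))"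
    by (rule bexp_Suc[OF p])
  also have "\<dots> = bexp n p (\<lambda>B. p * exp (F (Suc n) (insert (Suc n) B)) + (1 - p) * exp (F (Suc n) B))"
    by simp
  also have "\<dots> \<le> bexp n p (\<lambda>B. exp (F n B))"
  proof (rule bexp_mono)
    fix B :: "nat set" assume "B \<subseteq> {1..n}"
    then have nin: "Suc n \<notin> B" by auto
    let ?w = "W (Suc n) B"
    have "p * exp (F (Suc n) (insert (Suc n) B)) + (1 - p) * exp (F (Suc n) B) =
        exp (F n B) * exp (- c * ?w\<^sup>2) * cmgf p ?w"
    proof -
      have "F (Suc n) (insert (Suc n) B) = F n B + ((1 - p) * ?w - c * ?w\<^sup>2)"
        using ins[of B] by (simp add: F_def centered_def predictable_insert[OF W])
      moreover have "F (Suc n) B = F n B + (- p * ?w - c * ?w\<^sup>2)"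
        using nin by (simp add: F_def centered_def)
      ultimately show ?thesis
        by (simp only: cmgf_def exp_add exp_diff exp_minus mult_minus_left) (simp add: field_simps)
    qed
    also have "\<dots> \<le> exp (F n B) * exp (- c * ?w\<^sup>2) * exp (c * ?w\<^sup>2)"
      using cmgf_le[OF p bd[of "Suc n" B] \<epsilon>] by (intro mult_left_mono) (auto simp: c_def)
    also have "\<dots> = exp (F n B)" by (simp flip: exp_add)
    finally show "p * exp (F (Suc n) (insert (Suc n) B)) + (1 - p) * exp (F (Suc n) B) \<le> exp (F n B)" .
  qed
  also have "\<dots> \<le> 1" using Suc.IH by (simp add: F_def c_def)
  finally show ?case by (simp add: F_def c_def)
qed

text \<open>Exponential Markov inequality for the supermartingale with coefficients
  \<open>\<theta> * W\<close>; on the event its compensator is at most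
  \<open>\<theta>^2 * p * V\<close>. Boundedness by 1 turns the constant
  \<open>(1 + \<epsilon>) / 2\<close> into 1. The tilt \<theta> stays free for later
  optimisation.\<close>

lemma freedman:
  assumes p: "0 \<le> p" "p \<le> 1" and W: "predictable W"
    and bd: "\<And>i B. \<bar>\<theta> * W i B\<bar> \<le> 1" and lam: "0 \<le> \<theta>"
  shows "bprob n p (\<lambda>B. t \<le> (\<Sum>i=1..n. centered p B i * W i B) \<and> (\<Sum>i=1..n. (W i B)\<^sup>2) \<le> V)
    \<le> exp (- \<theta> * t + \<theta>\<^sup>2 * p * V)"
proof -
  have pred: "predictable (\<lambda>i B. \<theta> * W i B)"
    using W unfolding predictable_def by metis
  define F where "F = (\<lambda>B. \<Sum>i=1..n. centered p B i * (\<theta> * W i B)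
           - p * (1 - p) * (\<theta> * W i B)\<^sup>2)"
  have F: "bexp n p (\<lambda>B. exp (F B)) \<le> 1"
    using bexp_exp_supermartingale[OF p pred bd, of n] by (simp add: F_def)
  have "bprob n p (\<lambda>B. t \<le> (\<Sum>i=1..n. centered p B i * W i B) \<and> (\<Sum>i=1..n. (W i B)\<^sup>2) \<le> V)
    \<le> bexp n p (\<lambda>B. exp (- \<theta> * t + \<theta>\<^sup>2 * p * V) * exp (F B))"
    unfolding bprob_eq_bexp
  proof (rule bexp_mono)
    fix B
    show "of_bool (t \<le> (\<Sum>i=1..n. centered p B i * W i B) \<and> (\<Sum>i=1..n. (W i B)\<^sup>2) \<le> V)
      \<le> exp (- \<theta> * t + \<theta>\<^sup>2 * p * V) * exp (F B)"
    proof (cases "t \<le> (\<Sum>i=1..n. centered p B i * W i B) \<and> (\<Sum>i=1..n. (W i B)\<^sup>2) \<le> V")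
      case True
      have "F B = \<theta> * (\<Sum>i=1..n. centered p B i * W i B) - p * (1 - p) * \<theta>\<^sup>2 * (\<Sum>i=1..n. (W i B)\<^sup>2)"
        unfolding F_def by (simp add: sum_subtractf sum_distrib_left power_mult_distrib mult_ac)
      moreover have "\<theta> * t \<le> \<theta> * (\<Sum>i=1..n. centered p B i * W i B)"
        using True lam by (intro mult_left_mono) auto
      moreover have "p * (1 - p) * \<theta>\<^sup>2 * (\<Sum>i=1..n. (W i B)\<^sup>2) \<le> p * 1 * \<theta>\<^sup>2 * V"
        using True p by (intro mult_mono) (auto intro!: sum_nonneg)
      ultimately have "0 \<le> (- \<theta> * t + \<theta>\<^sup>2 * p * V) + F B"
        by (simp add: mult_ac)
      then show ?thesis using True by (simp flip: exp_add)
    qed auto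
  qed
  also have "\<dots> = exp (- \<theta> * t + \<theta>\<^sup>2 * p * V) * bexp n p (\<lambda>B. exp (F B))" by simp
  also have "\<dots> \<le> exp (- \<theta> * t + \<theta>\<^sup>2 * p * V)"
    using F by (simp add: mult_left_le)
  finally show ?thesis .
qed

lemma freedman_abs:
  assumes p: "0 \<le> p" "p \<le> 1" and W: "predictable W"
    and bd: "\<And>i B. \<bar>\<theta> * W i B\<bar> \<le> 1" and lam: "0 \<le> \<theta>"
  shows "bprob n p (\<lambda>B. t \<le> \<bar>\<Sum>i=1..n. centered p B i * W i B\<bar> \<and> (\<Sum>i=1..n. (W i B)\<^sup>2) \<le> V)
    \<le> 2 * exp (- \<theta> * t + \<theta>\<^sup>2 * p * V)"
proof -
  have pred: "predictable (\<lambda>i B. - W i B)"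
    using W unfolding predictable_def by metis
  have "bprob n p (\<lambda>B. t \<le> \<bar>\<Sum>i=1..n. centered p B i * W i B\<bar> \<and> (\<Sum>i=1..n. (W i B)\<^sup>2) \<le> V)
    \<le> bprob n p (\<lambda>B. (t \<le> (\<Sum>i=1..n. centered p B i * W i B) \<and> (\<Sum>i=1..n. (W i B)\<^sup>2) \<le> V) \<or>
        (t \<le> (\<Sum>i=1..n. centered p B i * - W i B) \<and> (\<Sum>i=1..n. (- W i B)\<^sup>2) \<le> V))"
    by (rule bprob_mono) (auto simp: sum_negf abs_le_iff abs_real_def split: if_splits)
  also have "\<dots> \<le> exp (- \<theta> * t + \<theta>\<^sup>2 * p * V) + exp (- \<theta> * t + \<theta>\<^sup>2 * p * V)"
    using bd by (intro order.trans[OF bprob_disj_le] add_mono freedman p W pred lam) auto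
  finally show ?thesis by simp
qed

section \<open>Exponential moments with deterministic weights\<close>

lemma bexp_exp_linear_le:
  assumes p: "0 \<le> p" "p \<le> 1" and bd: "\<And>i. i \<in> {1..n} \<Longrightarrow> \<bar>w i\<bar> \<le> \<epsilon>" and \<epsilon>: "0 \<le> \<epsilon>" "\<epsilon> \<le> 1"
  shows "bexp n p (\<lambda>B. exp (\<Sum>i=1..n. w i * centered p B i))
    \<le> exp (p * (1 - p) * (1 + \<epsilon>) * (\<Sum>i=1..n. (w i)\<^sup>2) / 2)"
proof -
  \<comment> \<open>Extension by zero, because the supermartingale bound asks for bounded
    coefficients at every index. For deterministic weights the compensator is a constant and leaves
    the expectation.\<close>
  define W where "W = (\<lambda>i (B::nat set). if i \<in> {1..n} then w i else 0)"
  define C where "C = p * (1 - p) * (1 + \<epsilon>) * (\<Sum>i=1..n. (w i)\<^sup>2) / 2"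
  have "predictable W" by (simp add: predictable_def W_def)
  moreover have "\<bar>W i B\<bar> \<le> \<epsilon>" for i B using bd[of i] \<epsilon> by (auto simp: W_def)
  ultimately have *: "bexp n p (\<lambda>B. exp (\<Sum>i=1..n. centered p B i * W i B
           - p * (1 - p) * (1 + \<epsilon>) / 2 * (W i B)\<^sup>2)) \<le> 1"
    using bexp_exp_supermartingale[OF p] \<epsilon> by blast
  have eq: "(\<Sum>i=1..n. centered p B i * W i B - p * (1 - p) * (1 + \<epsilon>) / 2 * (W i B)\<^sup>2) =
      (\<Sum>i=1..n. w i * centered p B i) - C" for B
    unfolding C_def
    by (simp add: W_def sum_subtractf sum_distrib_left sum_divide_distrib mult_ac)
  have "bexp n p (\<lambda>B. exp (\<Sum>i=1..n. w i * centered p B i)) / exp C \<le> 1"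
    using * unfolding eq by (simp add: exp_diff)
  then show ?thesis by (simp add: C_def)
qed

text \<open>The supermartingale gives only upper bounds, so the lower bound has its own induction:
  each vertex contributes an independent factor \<open>cmgf p (w i)\<close>, estimated by
  \<open>cmgf_ge\<close>.\<close>

lemma bexp_exp_linear_ge:
  assumes p: "0 \<le> p" "p \<le> 1" and bd: "\<And>i. i \<in> {1..n} \<Longrightarrow> \<bar>w i\<bar> \<le> \<epsilon>" and \<epsilon>: "\<epsilon> \<le> 1"
  shows "exp (p * (1 - p) * (1 - 2 * \<epsilon>) * (\<Sum>i=1..n. (w i)\<^sup>2) / 2)
    \<le> bexp n p (\<lambda>B. exp (\<Sum>i=1..n. w i * centered p B i))"
  using bd
proof (induction n)
  case 0
  show ?case by (simp add: bexp_0)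
next
  case (Suc n)
  define F where "F = (\<lambda>k B. \<Sum>i=1..k. w i * centered p B i)"
  let ?S = "\<lambda>k. exp (p * (1 - p) * (1 - 2 * \<epsilon>) * (\<Sum>i=1..k. (w i)\<^sup>2) / 2)"
  let ?w = "w (Suc n)"
  have ins: "F n (insert (Suc n) B) = F n B" for B
    unfolding F_def by (intro sum.cong refl) (auto simp: centered_insert)
  have "?S (Suc n) = ?S n * exp (p * (1 - p) * (1 - 2 * \<epsilon>) * ?w\<^sup>2 / 2)"
    by (simp add: algebra_simps add_divide_distrib diff_divide_distrib flip: exp_add)
  also have "\<dots> \<le> bexp n p (\<lambda>B. exp (F n B)) * cmgf p ?w"
    unfolding F_def using Suc.prems \<epsilon>
    by (intro mult_mono Suc.IH cmgf_ge p) (auto intro!: Bochner_Integration.integral_nonneg)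
  also have "\<dots> = bexp n p (\<lambda>B. exp (F n B) * cmgf p ?w)" by simp
  also have "\<dots> \<le> bexp n p (\<lambda>B. p * exp (F (Suc n) (insert (Suc n) B)) + (1 - p) * exp (F (Suc n) B))"
  proof (rule bexp_mono)
    fix B :: "nat set" assume "B \<subseteq> {1..n}"
    then have nin: "Suc n \<notin> B" by auto
    have "F (Suc n) (insert (Suc n) B) = F n B + (1 - p) * ?w"
      using ins[of B] by (simp add: F_def centered_def)
    moreover have "F (Suc n) B = F n B + (- p * ?w)"
      using nin by (simp add: F_def centered_def)
    ultimately show "exp (F n B) * cmgf p ?w \<le>
        p * exp (F (Suc n) (insert (Suc n) B)) + (1 - p) * exp (F (Suc n) B)"
      by (simp only: cmgf_def exp_add) (simp add: algebra_simps)
  qed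
  also have "\<dots> = p * bexp n p (\<lambda>B. exp (F (Suc n) (insert (Suc n) B))) + (1 - p) * bexp n p (\<lambda>B. exp (F (Suc n) B))"
    by simp
  also have "\<dots> = bexp (Suc n) p (\<lambda>B. exp (F (Suc n) B))"
    by (rule bexp_Suc[OF p, symmetric])
  finally show ?case by (simp add: F_def)
qed

lemma abs_centered_le:
  assumes "0 \<le> p" "p \<le> 1"
  shows "\<bar>centered p B i\<bar> \<le> 1"
  using assms by (auto simp: centered_def)

section \<open>The remainder term\<close>

text \<open>Injectivity of \<open>f\<close> turns the sum into one with 0-1 weights, whose squares
  add up to at most \<open>n\<close>. It serves the linear pieces of
  \<open>ap_weight\<close>.\<close>

lemma linear_tail:
  assumes p: "0 \<le> p" "p \<le> 1" and f: "finite S" "inj_on f S" "f ` S \<subseteq> {1..n}"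
    and th: "0 \<le> \<theta>" "\<theta> \<le> 1"
  shows "bprob n p (\<lambda>B. t \<le> \<bar>\<Sum>d\<in>S. centered p B (f d)\<bar>) \<le> 2 * exp (- \<theta> * t + \<theta>\<^sup>2 * p * real n)"
proof -
  define W where "W = (\<lambda>i (B::nat set). of_bool (i \<in> f ` S) :: real)"
  have eq: "(\<Sum>i=1..n. centered p B i * W i B) = (\<Sum>d\<in>S. centered p B (f d))" for B
  proof -
    have "(\<Sum>i=1..n. centered p B i * W i B) = (\<Sum>i\<in>f ` S. centered p B i)"
      using f by (intro sum.mono_neutral_cong_right) (auto simp: W_def)
    then show ?thesis by (simp add: sum.reindex f)
  qed
  have "(\<Sum>i=1..n. (W i B)\<^sup>2) \<le> (\<Sum>i=1..n. 1)" for B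
    by (intro sum_mono) (simp add: W_def)
  then have V: "(\<Sum>i=1..n. (W i B)\<^sup>2) \<le> real n" for B by simp
  have "bprob n p (\<lambda>B. t \<le> \<bar>\<Sum>i=1..n. centered p B i * W i B\<bar> \<and> (\<Sum>i=1..n. (W i B)\<^sup>2) \<le> real n)
    \<le> 2 * exp (- \<theta> * t + \<theta>\<^sup>2 * p * real n)"
    using th by (intro freedman_abs p) (auto simp: W_def predictable_def)
  then show ?thesis using V unfolding eq by simp
qed

text \<open>Pointwise, the square of a centred indicator \<open>y\<close> is at most
  \<open>y + 2 * p\<close>. An excess of \<open>p * n\<close> in the squares thus forces the sum of
  the \<open>y\<close> up to \<open>p * n\<close>, which Freedman's inequality with unit
  coefficients and tilt 1/2 controls.\<close>

lemma sum_centered_square_tail: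
  assumes p: "0 \<le> p" "p \<le> 1"
  shows "bprob n p (\<lambda>B. 3 * p * real n < (\<Sum>i=1..n. (centered p B i)\<^sup>2)) \<le> exp (- p * real n / 4)"
proof -
  have sq: "(centered p B i)\<^sup>2 \<le> centered p B i + 2 * p" for B i
    using p mult_left_le[of p p] by (auto simp: centered_def power2_eq_square algebra_simps)
  have le: "(\<Sum>i=1..n. (centered p B i)\<^sup>2) \<le> (\<Sum>i=1..n. centered p B i) + 2 * p * real n" for B
    using sum_mono[of "{1..n}" "\<lambda>i. (centered p B i)\<^sup>2" "\<lambda>i. centered p B i + 2 * p"] sq
    by (simp add: sum.distrib mult_ac)
  have "p * real n \<le> (\<Sum>i=1..n. centered p B i)" if "3 * p * real n < (\<Sum>i=1..n. (centered p B i)\<^sup>2)" for B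
    using that le[of B] by linarith
  then have "bprob n p (\<lambda>B. 3 * p * real n < (\<Sum>i=1..n. (centered p B i)\<^sup>2))
      \<le> bprob n p (\<lambda>B. p * real n \<le> (\<Sum>i=1..n. centered p B i * 1) \<and> (\<Sum>i=1..n. (1::real)\<^sup>2) \<le> real n)"
    by (intro bprob_mono) auto
  also have "\<dots> \<le> exp (- (1 / 2) * (p * real n) + (1 / 2)\<^sup>2 * p * real n)"
    by (intro freedman p) (auto simp: predictable_def)
  also have "\<dots> = exp (- p * real n / 4)" by (simp add: power2_eq_square)
  finally show ?thesis .
qed

section \<open>Tails of the martingale coefficients in the remainder\<close>

definition gaps_below :: "nat \<Rightarrow> nat set" where
  "gaps_below i = {d. 1 \<le> d \<and> 2 * d < i}"

text \<open>Both gap sets list the differences of progressions through a marked vertex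
  \<open>i\<close>: here \<open>i\<close> is the middle element, in \<open>gaps_below\<close> the
  last one. The strict inequalities keep the first element at least 1.\<close>

definition gaps_around :: "nat \<Rightarrow> nat \<Rightarrow> nat set" where
  "gaps_around n i = {d. 1 \<le> d \<and> d < i \<and> i + d \<le> n}"

lemma finite_gaps [simp]: "finite (gaps_below i)" "finite (gaps_around n i)"
  by (rule finite_subset[of _ "{..i}"]; auto simp: gaps_below_def gaps_around_def)+

text \<open>Ordered by the middle element \<open>k = i - d\<close>, the sum is a martingale whose coefficient at \<open>k\<close> is
  the earlier variable \<open>y\<^bsub>2k-i\<^esub>\<close>, so its quadratic variation is at most the sum of all \<open>y\<^sub>j\<^sup>2\<close>,
  which exceeds \<open>3 p n\<close> only with exponentially small probability.\<close>

lemma quadratic_tail: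
  assumes p: "0 \<le> p" "p \<le> 1" and i: "i \<le> n" and th: "0 \<le> \<theta>" "\<theta> \<le> 1"
  shows "bprob n p (\<lambda>B. t \<le> \<bar>\<Sum>d\<in>gaps_below i. centered p B (i - d) * centered p B (i - 2 * d)\<bar>)
    \<le> exp (- p * real n / 4) + 2 * exp (- \<theta> * t + \<theta>\<^sup>2 * p * (3 * p * real n))"
proof -
  \<comment> \<open>The middle element \<open>k\<close> determines the first one,
    \<open>2 * k - i\<close>. The two conditions place it between 1 and \<open>k - 1\<close>, so the
    natural subtraction is exact and the coefficient predictable.\<close>
  define W where "W = (\<lambda>k B. if k < i \<and> i < 2 * k then centered p B (2 * k - i) else 0)"
  let ?K = "{k. k < i \<and> i < 2 * k}"
  have "centered p (B \<inter> {..<k}) (2 * k - i) = centered p B (2 * k - i)" if "k < i" "i < 2 * k" for k B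
    using that by (intro centered_inter) auto
  then have pred: "predictable W" by (auto simp: predictable_def W_def)
  have im: "(\<lambda>d. i - d) ` gaps_below i = ?K"
  proof (intro equalityI subsetI)
    fix k assume "k \<in> ?K"
    then show "k \<in> (\<lambda>d. i - d) ` gaps_below i"
      by (intro image_eqI[of _ _ "i - k"]) (auto simp: gaps_below_def)
  qed (auto simp: gaps_below_def)
  have inj: "inj_on (\<lambda>d. i - d) (gaps_below i)"
    by (auto simp: inj_on_def gaps_below_def)
  have "(\<Sum>k=1..n. centered p B k * W k B) = (\<Sum>k\<in>?K. centered p B k * centered p B (2 * k - i))" for B
    using i by (intro sum.mono_neutral_cong_right) (auto simp: W_def)
  also have "(\<Sum>k\<in>?K. centered p B k * centered p B (2 * k - i)) =
      (\<Sum>d\<in>gaps_below i. centered p B (i - d) * centered p B (i - 2 * d))" for B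
    unfolding im[symmetric] sum.reindex[OF inj] o_def
  proof (intro sum.cong refl)
    fix d assume "d \<in> gaps_below i"
    then have "2 * (i - d) - i = i - 2 * d" by (simp add: gaps_below_def)
    then show "centered p B (i - d) * centered p B (2 * (i - d) - i) =
        centered p B (i - d) * centered p B (i - 2 * d)" by (simp only:)
  qed
  finally have eq: "(\<Sum>k=1..n. centered p B k * W k B) =
      (\<Sum>d\<in>gaps_below i. centered p B (i - d) * centered p B (i - 2 * d))" for B .
  have sq: "(\<Sum>k=1..n. (W k B)\<^sup>2) \<le> (\<Sum>j=1..n. (centered p B j)\<^sup>2)" for B
  proof -
    have inj2: "inj_on (\<lambda>k. 2 * k - i) ?K" by (auto simp: inj_on_def)
    have "(\<Sum>k=1..n. (W k B)\<^sup>2) = (\<Sum>k\<in>?K. (centered p B (2 * k - i))\<^sup>2)"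
      using i by (intro sum.mono_neutral_cong_right) (auto simp: W_def)
    also have "\<dots> = (\<Sum>j\<in>(\<lambda>k. 2 * k - i) ` ?K. (centered p B j)\<^sup>2)"
      by (simp add: sum.reindex[OF inj2])
    also have "\<dots> \<le> (\<Sum>j=1..n. (centered p B j)\<^sup>2)"
      using i by (intro sum_mono2) auto
    finally show ?thesis .
  qed
  have "bprob n p (\<lambda>B. t \<le> \<bar>\<Sum>k=1..n. centered p B k * W k B\<bar>)
     \<le> bprob n p (\<lambda>B. 3 * p * real n < (\<Sum>i=1..n. (centered p B i)\<^sup>2) \<or>
        (t \<le> \<bar>\<Sum>k=1..n. centered p B k * W k B\<bar> \<and> (\<Sum>k=1..n. (W k B)\<^sup>2) \<le> 3 * p * real n))"
    by (rule bprob_mono) (use sq in \<open>meson order.trans not_le\<close>)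
  also have "\<dots> \<le> exp (- p * real n / 4) + 2 * exp (- \<theta> * t + \<theta>\<^sup>2 * p * (3 * p * real n))"
  proof (intro order.trans[OF bprob_disj_le] add_mono sum_centered_square_tail freedman_abs p pred th)
    show "\<bar>\<theta> * W k B\<bar> \<le> 1" for k B
      using th abs_centered_le[OF p, of B "2 * k - i"] mult_mono[of \<theta> 1 "\<bar>centered p B (2 * k - i)\<bar>" 1]
      by (auto simp: W_def abs_mult)
  qed
  finally show ?thesis by (simp only: eq)
qed

text \<open>The coefficient of \<open>y\<^sub>i\<close> in the nonlinear part: the first three sums come from progressions with
  last element \<open>i\<close>, the fourth from the pair of the first and middle elements when \<open>i\<close> is the middle one.\<close>

definition ap_weight :: "nat \<Rightarrow> real \<Rightarrow> nat \<Rightarrow> nat set \<Rightarrow> real" where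
  "ap_weight n p i B =
     p * (\<Sum>d\<in>gaps_below i. centered p B (i - 2 * d))
     + p * (\<Sum>d\<in>gaps_below i. centered p B (i - d))
     + (\<Sum>d\<in>gaps_below i. centered p B (i - d) * centered p B (i - 2 * d))
     + p * (\<Sum>d\<in>gaps_around n i. centered p B (i - d))"

lemma predictable_ap_weight: "predictable (ap_weight n p)"
proof -
  have "centered p (B \<inter> {..<i}) (i - 2 * d) = centered p B (i - 2 * d)"
    "centered p (B \<inter> {..<i}) (i - d) = centered p B (i - d)" if "d \<in> gaps_below i" for i d B
    using that by (auto intro!: centered_inter simp: gaps_below_def)
  moreover have "centered p (B \<inter> {..<i}) (i - d) = centered p B (i - d)" if "d \<in> gaps_around n i" for i d B
    using that by (auto intro!: centered_inter simp: gaps_around_def)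
  ultimately show ?thesis
    by (simp add: predictable_def ap_weight_def)
qed

text \<open>The level is split into four equal shares \<open>p * t\<close>, one per sum in
  \<open>ap_weight\<close>. The quadratic sum gives the weakest exponent and dictates the bound; the
  constant is 9 = 2 + 2 + 3 + 2.\<close>

lemma ap_weight_tail:
  assumes p: "0 < p" "p \<le> 1" and i: "i \<le> n" and g: "0 < \<gamma>" "\<gamma> \<le> 1"
  shows "bprob n p (\<lambda>B. \<gamma> * p\<^sup>2 * real n < \<bar>ap_weight n p i B\<bar>)
    \<le> 9 * exp (- (\<gamma>\<^sup>2 * p\<^sup>2 * real n / 192))"
proof -
  have p': "0 \<le> p" using p by simp
  let ?y = "centered p"
  define t where "t = \<gamma> * p * real n / 4"
  define e where "e = exp (- (\<gamma>\<^sup>2 * p\<^sup>2 * real n / 192))"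
  define L where "L = (\<lambda>(S :: nat set) f B. \<bar>\<Sum>d\<in>S. ?y B (f d)\<bar>)"
  define Z where "Z = (\<lambda>B. \<bar>\<Sum>d\<in>gaps_below i. ?y B (i - d) * ?y B (i - 2 * d)\<bar>)"
  have "p\<^sup>2 \<le> p" using p by (simp add: power2_eq_square mult_left_le)
  then have "\<gamma>\<^sup>2 * p\<^sup>2 * real n \<le> \<gamma>\<^sup>2 * p * real n"
    by (intro mult_right_mono mult_left_mono) auto
  moreover have "\<gamma>\<^sup>2 * p * real n \<le> 1 * p * real n"
    using p g power_le_one[of \<gamma> 2] by (intro mult_right_mono) auto
  ultimately have ple: "\<gamma>\<^sup>2 * p\<^sup>2 * real n \<le> \<gamma>\<^sup>2 * p * real n" "\<gamma>\<^sup>2 * p * real n \<le> p * real n"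
    by simp_all
  have lin: "bprob n p (\<lambda>B. t \<le> L S f B) \<le> 2 * e"
    if "finite S" "inj_on f S" "f ` S \<subseteq> {1..n}" for S :: "nat set" and f
  proof -
    \<comment> \<open>The tilt \<open>\<gamma> / 8\<close> minimises this exponent.\<close>
    have "bprob n p (\<lambda>B. t \<le> L S f B) \<le> 2 * exp (- (\<gamma> / 8) * t + (\<gamma> / 8)\<^sup>2 * p * real n)"
      unfolding L_def using g by (intro linear_tail p' p that) auto
    also have "- (\<gamma> / 8) * t + (\<gamma> / 8)\<^sup>2 * p * real n = - (\<gamma>\<^sup>2 * p * real n / 64)"
      by (simp add: t_def power2_eq_square)
    also have "exp \<dots> \<le> e"
    proof -
      have "0 \<le> \<gamma>\<^sup>2 * p * real n" using p by simp
      then have "\<gamma>\<^sup>2 * p\<^sup>2 * real n / 192 \<le> \<gamma>\<^sup>2 * p * real n / 64" using ple by linarith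
      then show ?thesis by (simp add: e_def)
    qed
    finally show ?thesis by simp
  qed
  have quad: "bprob n p (\<lambda>B. p * t \<le> Z B) \<le> 3 * e"
  proof -
    \<comment> \<open>Likewise \<open>\<gamma> / 24\<close> is the minimiser once the variation
      bound is \<open>3 * p * n\<close>.\<close>
    have "bprob n p (\<lambda>B. p * t \<le> Z B)
      \<le> exp (- p * real n / 4) + 2 * exp (- (\<gamma> / 24) * (p * t) + (\<gamma> / 24)\<^sup>2 * p * (3 * p * real n))"
      unfolding Z_def using g by (intro quadratic_tail p' p i) auto
    also have "- (\<gamma> / 24) * (p * t) + (\<gamma> / 24)\<^sup>2 * p * (3 * p * real n) = - (\<gamma>\<^sup>2 * p\<^sup>2 * real n / 192)"
      by (simp add: t_def power2_eq_square)
    also have "exp (- p * real n / 4) \<le> e"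
    proof -
      have "0 \<le> p * real n" using p by simp
      then have "\<gamma>\<^sup>2 * p\<^sup>2 * real n / 192 \<le> p * real n / 4" using ple by linarith
      then show ?thesis by (simp add: e_def)
    qed
    finally show ?thesis by (simp add: e_def)
  qed
  have "bprob n p (\<lambda>B. \<gamma> * p\<^sup>2 * real n < \<bar>ap_weight n p i B\<bar>)
    \<le> bprob n p (\<lambda>B. t \<le> L (gaps_below i) (\<lambda>d. i - 2 * d) B \<or> t \<le> L (gaps_below i) (\<lambda>d. i - d) B
        \<or> p * t \<le> Z B \<or> t \<le> L (gaps_around n i) (\<lambda>d. i - d) B)"
  proof (rule bprob_mono)
    fix B
    define l1 l2 l3 where "l1 = L (gaps_below i) (\<lambda>d. i - 2 * d) B"
      and "l2 = L (gaps_below i) (\<lambda>d. i - d) B" and "l3 = L (gaps_around n i) (\<lambda>d. i - d) B"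
    have "\<bar>ap_weight n p i B\<bar> \<le> p * l1 + p * l2 + Z B + p * l3"
      unfolding ap_weight_def l1_def l2_def l3_def L_def Z_def
      using p' by (intro order.trans[OF abs_triangle_ineq] add_mono) (auto simp: abs_mult)
    moreover assume "\<gamma> * p\<^sup>2 * real n < \<bar>ap_weight n p i B\<bar>"
    moreover have "\<gamma> * p\<^sup>2 * real n = p * t + p * t + p * t + p * t"
      by (simp add: t_def power2_eq_square)
    ultimately have "t \<le> l1 \<or> t \<le> l2 \<or> p * t \<le> Z B \<or> t \<le> l3"
      using p mult_strict_left_mono[of l1 t p] mult_strict_left_mono[of l2 t p]
        mult_strict_left_mono[of l3 t p] by linarith
    then show "t \<le> L (gaps_below i) (\<lambda>d. i - 2 * d) B \<or> t \<le> L (gaps_below i) (\<lambda>d. i - d) B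
        \<or> p * t \<le> Z B \<or> t \<le> L (gaps_around n i) (\<lambda>d. i - d) B"
      by (simp add: l1_def l2_def l3_def)
  qed
  also have "\<dots> \<le> 2 * e + (2 * e + (3 * e + 2 * e))"
    using i by (intro order.trans[OF bprob_disj_le] add_mono lin quad)
      (simp_all add: inj_on_def image_subset_iff, auto simp: gaps_below_def gaps_around_def)
  finally show ?thesis by (simp add: e_def)
qed

text \<open>Freedman's inequality asks for coefficients bounded on every outcome, so those above the
  level are replaced by zero, which preserves predictability. The two sums can differ only if some
  coefficient exceeds the level, and a union bound over the \<open>n\<close> vertices covers
  that.\<close>

lemma remainder_tail:
  assumes p: "0 < p" "p \<le> 1" and g: "0 < \<gamma>" "\<gamma> \<le> 1"
    and th: "0 \<le> \<theta>" "\<theta> * (\<gamma> * p\<^sup>2 * real n) \<le> 1"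
  shows "bprob n p (\<lambda>B. t \<le> \<bar>\<Sum>i=1..n. centered p B i * ap_weight n p i B\<bar>)
    \<le> 9 * real n * exp (- (\<gamma>\<^sup>2 * p\<^sup>2 * real n / 192))
      + 2 * exp (- \<theta> * t + \<theta>\<^sup>2 * p * (real n * (\<gamma> * p\<^sup>2 * real n)\<^sup>2))"
proof -
  have p': "0 \<le> p" using p by simp
  define w where "w = \<gamma> * p\<^sup>2 * real n"
  have w0: "0 \<le> w" using p g by (simp add: w_def)
  define W where "W = (\<lambda>i B. if \<bar>ap_weight n p i B\<bar> \<le> w then ap_weight n p i B else 0)"
  have pred: "predictable W"
    using predictable_ap_weight[of n p] unfolding predictable_def W_def by metis
  have Wle: "\<bar>W i B\<bar> \<le> w" for i B using w0 by (simp add: W_def)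
  have "(\<Sum>i=1..n. (W i B)\<^sup>2) \<le> (\<Sum>i=1..n. w\<^sup>2)" for B
    using Wle w0 by (intro sum_mono) (simp add: abs_le_square_iff[symmetric])
  then have V: "(\<Sum>i=1..n. (W i B)\<^sup>2) \<le> real n * w\<^sup>2" for B by simp
  have "bprob n p (\<lambda>B. t \<le> \<bar>\<Sum>i=1..n. centered p B i * ap_weight n p i B\<bar>)
    \<le> bprob n p (\<lambda>B. (\<exists>i\<in>{1..n}. w < \<bar>ap_weight n p i B\<bar>) \<or>
        (t \<le> \<bar>\<Sum>i=1..n. centered p B i * W i B\<bar> \<and> (\<Sum>i=1..n. (W i B)\<^sup>2) \<le> real n * w\<^sup>2))"
  proof (rule bprob_mono, rule disjCI)
    fix B
    assume *: "t \<le> \<bar>\<Sum>i=1..n. centered p B i * ap_weight n p i B\<bar>"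
      and neg: "\<not> (t \<le> \<bar>\<Sum>i=1..n. centered p B i * W i B\<bar> \<and> (\<Sum>i=1..n. (W i B)\<^sup>2) \<le> real n * w\<^sup>2)"
    show "\<exists>i\<in>{1..n}. w < \<bar>ap_weight n p i B\<bar>"
    proof (rule ccontr)
      assume "\<not> ?thesis"
      then have "(\<Sum>i=1..n. centered p B i * W i B) = (\<Sum>i=1..n. centered p B i * ap_weight n p i B)"
        by (intro sum.cong refl) (simp add: W_def not_less)
      then show False using * neg V by simp
    qed
  qed
  also have "\<dots> \<le> (\<Sum>i=1..n. 9 * exp (- (\<gamma>\<^sup>2 * p\<^sup>2 * real n / 192)))
      + 2 * exp (- \<theta> * t + \<theta>\<^sup>2 * p * (real n * w\<^sup>2))"
  proof (intro order.trans[OF bprob_disj_le] order.trans[OF bprob_Bex_le] add_mono sum_mono freedman_abs p p' pred th)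
    show "bprob n p (\<lambda>B. w < \<bar>ap_weight n p i B\<bar>) \<le> 9 * exp (- (\<gamma>\<^sup>2 * p\<^sup>2 * real n / 192))" if "i \<in> {1..n}" for i
      unfolding w_def by (rule ap_weight_tail) (use that p g in auto)
    show "\<bar>\<theta> * W i B\<bar> \<le> 1" for i B
      using mult_left_mono[OF Wle[of i B] th(1)] th by (simp add: abs_mult w_def)
  qed auto
  finally show ?thesis by (simp add: w_def)
qed

section \<open>Decomposition of the progression count\<close>

definition ap3_params :: "nat \<Rightarrow> (nat \<times> nat) set" where
  "ap3_params n = {(a, d). 1 \<le> a \<and> 1 \<le> d \<and> a + 2 * d \<le> n}"

text \<open>The summands count the progressions in which \<open>i\<close> is the first, the middle
  and the last element.\<close>

definition ap3_degree :: "nat \<Rightarrow> nat \<Rightarrow> nat" where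
  "ap3_degree n i = (n - i) div 2 + min (i - 1) (n - i) + (i - 1) div 2"

definition ap3_linear :: "nat \<Rightarrow> real \<Rightarrow> nat set \<Rightarrow> real" where
  "ap3_linear n p B = (\<Sum>i=1..n. real (ap3_degree n i) * centered p B i)"

lemma finite_ap3_params [simp]: "finite (ap3_params n)"
  by (rule finite_subset[of _ "{..n} \<times> {..n}"]) (auto simp: ap3_params_def)

lemma ap3_hypergraph_eq_image:
  "ap3_hypergraph n = (\<lambda>(a, d). {a, a + d, a + 2 * d}) ` ap3_params n"
proof -
  have "d \<ge> 1 \<and> {a, a + d, a + 2 * d} \<subseteq> {1..n} \<longleftrightarrow> (a, d) \<in> ap3_params n" for a d
    by (auto simp: ap3_params_def)
  then show ?thesis unfolding ap3_hypergraph_def by (auto simp: image_def)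
qed

text \<open>Minimum and maximum of a progression recover \<open>a\<close> and
  \<open>a + 2 * d\<close>, so edges can be counted through their parameters.\<close>

lemma inj_on_ap3: "inj_on (\<lambda>(a, d). {a, a + d, a + 2 * d}) (ap3_params n)"
proof (rule inj_onI, clarsimp simp: ap3_params_def)
  fix a d a' d' :: nat
  assume d: "Suc 0 \<le> d" "Suc 0 \<le> d'" and eq: "{a, a + d, a + 2 * d} = {a', a' + d', a' + 2 * d'}"
  have "Min {a, a + d, a + 2 * d} = a" "Min {a', a' + d', a' + 2 * d'} = a'" by auto
  then have "a = a'" using eq by simp
  moreover have "Max {a, a + d, a + 2 * d} = a + 2 * d" "Max {a', a' + d', a' + 2 * d'} = a' + 2 * d'"
    by auto
  then have "a + 2 * d = a' + 2 * d'" using eq by simp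
  ultimately show "a = a' \<and> d = d'" by simp
qed

lemma deviation3_eq_sum:
  "deviation3 (ap3_hypergraph n) p B =
    (\<Sum>(a, d)\<in>ap3_params n. of_bool (a \<in> B) * of_bool (a + d \<in> B) * of_bool (a + 2 * d \<in> B) - p ^ 3)"
proof -
  let ?f = "\<lambda>(a, d). {a, a + d, a + 2 * d} :: nat set"
  have "{e \<in> ap3_hypergraph n. e \<subseteq> B} = ?f ` {x \<in> ap3_params n. ?f x \<subseteq> B}"
    unfolding ap3_hypergraph_eq_image by auto
  then have "edges_within (ap3_hypergraph n) B = card {x \<in> ap3_params n. ?f x \<subseteq> B}"
    unfolding edges_within_def
    by (simp only:) (intro card_image inj_on_subset[OF inj_on_ap3], auto)
  also have "real \<dots> = (\<Sum>x\<in>ap3_params n. of_bool (?f x \<subseteq> B))"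
    by (simp add: Int_def)
  also have "\<dots> = (\<Sum>(a, d)\<in>ap3_params n. of_bool (a \<in> B) * of_bool (a + d \<in> B) * of_bool (a + 2 * d \<in> B))"
    by (intro sum.cong) auto
  finally show ?thesis
    unfolding deviation3_def ap3_hypergraph_eq_image card_image[OF inj_on_ap3]
    by (simp add: sum_subtractf case_prod_unfold)
qed

text \<open>This and the next two lemmas enumerate the same progressions by first, middle or last
  element, so that each monomial can be attached to a chosen vertex.\<close>

lemma sum_ap3_first:
  "(\<Sum>(a, d)\<in>ap3_params n. f a d) = (\<Sum>i=1..n. \<Sum>d\<in>{1..(n - i) div 2}. f i d)"
proof -
  have "ap3_params n = (SIGMA i:{1..n}. {1..(n - i) div 2})" by (auto simp: ap3_params_def)
  then show ?thesis by (simp add: sum.Sigma)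
qed

lemma sum_ap3_middle:
  "(\<Sum>(a, d)\<in>ap3_params n. f a d) = (\<Sum>i=1..n. \<Sum>d\<in>gaps_around n i. f (i - d) d)"
proof -
  have "(\<Sum>(a, d)\<in>ap3_params n. f a d) = (\<Sum>(i, d)\<in>(SIGMA i:{1..n}. gaps_around n i). f (i - d) d)"
    by (rule sum.reindex_bij_witness[of _ "\<lambda>(i, d). (i - d, d)" "\<lambda>(a, d). (a + d, d)"])
      (auto simp: ap3_params_def gaps_around_def)
  then show ?thesis by (simp add: sum.Sigma)
qed

lemma sum_ap3_last:
  "(\<Sum>(a, d)\<in>ap3_params n. f a d) = (\<Sum>i=1..n. \<Sum>d\<in>gaps_below i. f (i - 2 * d) d)"
proof -
  have "(\<Sum>(a, d)\<in>ap3_params n. f a d) = (\<Sum>(i, d)\<in>(SIGMA i:{1..n}. gaps_below i). f (i - 2 * d) d)"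
    by (rule sum.reindex_bij_witness[of _ "\<lambda>(i, d). (i - 2 * d, d)" "\<lambda>(a, d). (a + 2 * d, d)"])
      (auto simp: ap3_params_def gaps_below_def)
  then show ?thesis by (simp add: sum.Sigma)
qed

lemma card_gaps_below: "card (gaps_below i) = (i - 1) div 2"
proof -
  have "gaps_below i = {1..(i - 1) div 2}" by (auto simp: gaps_below_def)
  then show ?thesis by simp
qed

lemma card_gaps_around: "card (gaps_around n i) = min (i - 1) (n - i)"
proof -
  have "gaps_around n i = {1..min (i - 1) (n - i)}" by (auto simp: gaps_around_def)
  then show ?thesis by simp
qed

text \<open>Every nonlinear monomial is charged to its largest vertex, which makes the coefficients
  \<open>ap_weight\<close> predictable.\<close>

lemma deviation3_decomposition:
  "deviation3 (ap3_hypergraph n) p B =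
    p\<^sup>2 * ap3_linear n p B + (\<Sum>i=1..n. centered p B i * ap_weight n p i B)"
proof -
  let ?y = "centered p B"
  \<comment> \<open>Expansion of the product of the \<open>p + y\<close>. The products containing
    \<open>?y c\<close> go to the last element \<open>c\<close>; the remaining one, of
    \<open>?y a\<close> and \<open>?y b\<close>, goes to the middle element
    \<open>b\<close>.\<close>
  have pt: "of_bool (a \<in> B) * of_bool (b \<in> B) * of_bool (c \<in> B) - p ^ 3 =
      p\<^sup>2 * ?y a + p\<^sup>2 * ?y b + p\<^sup>2 * ?y c + ?y c * (p * ?y a + p * ?y b + ?y b * ?y a) + ?y b * (p * ?y a)"
    for a b c
    by (simp add: centered_def power2_eq_square power3_eq_cube algebra_simps)
  have "deviation3 (ap3_hypergraph n) p B =
      (\<Sum>(a, d)\<in>ap3_params n. p\<^sup>2 * ?y a) + (\<Sum>(a, d)\<in>ap3_params n. p\<^sup>2 * ?y (a + d))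
      + (\<Sum>(a, d)\<in>ap3_params n. p\<^sup>2 * ?y (a + 2 * d))
      + (\<Sum>(a, d)\<in>ap3_params n. ?y (a + 2 * d) * (p * ?y a + p * ?y (a + d) + ?y (a + d) * ?y a))
      + (\<Sum>(a, d)\<in>ap3_params n. ?y (a + d) * (p * ?y a))"
    unfolding deviation3_eq_sum pt by (simp add: sum.distrib case_prod_unfold)
  also have "(\<Sum>(a, d)\<in>ap3_params n. p\<^sup>2 * ?y a) = (\<Sum>i=1..n. p\<^sup>2 * (real ((n - i) div 2) * ?y i))"
    unfolding sum_ap3_first by (intro sum.cong) auto
  also have "(\<Sum>(a, d)\<in>ap3_params n. p\<^sup>2 * ?y (a + d)) = (\<Sum>i=1..n. p\<^sup>2 * (real (min (i - 1) (n - i)) * ?y i))"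
    unfolding sum_ap3_middle card_gaps_around[symmetric]
    by (intro sum.cong refl) (simp add: gaps_around_def)
  also have "(\<Sum>(a, d)\<in>ap3_params n. p\<^sup>2 * ?y (a + 2 * d)) = (\<Sum>i=1..n. p\<^sup>2 * (real ((i - 1) div 2) * ?y i))"
    unfolding sum_ap3_last card_gaps_below[symmetric]
    by (intro sum.cong refl) (simp add: gaps_below_def)
  also have "(\<Sum>(a, d)\<in>ap3_params n. ?y (a + 2 * d) * (p * ?y a + p * ?y (a + d) + ?y (a + d) * ?y a)) =
      (\<Sum>i=1..n. ?y i * (\<Sum>d\<in>gaps_below i. p * ?y (i - 2 * d) + p * ?y (i - d) + ?y (i - d) * ?y (i - 2 * d)))"
    unfolding sum_ap3_last sum_distrib_left
  proof (intro sum.cong refl)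
    fix i d assume "d \<in> gaps_below i"
    then have "i - 2 * d + 2 * d = i" "i - 2 * d + d = i - d" by (auto simp: gaps_below_def)
    then show "?y (i - 2 * d + 2 * d) * (p * ?y (i - 2 * d) + p * ?y (i - 2 * d + d)
          + ?y (i - 2 * d + d) * ?y (i - 2 * d)) =
        ?y i * (p * ?y (i - 2 * d) + p * ?y (i - d) + ?y (i - d) * ?y (i - 2 * d))"
      by (simp only:)
  qed
  also have "(\<Sum>(a, d)\<in>ap3_params n. ?y (a + d) * (p * ?y a)) = (\<Sum>i=1..n. ?y i * (\<Sum>d\<in>gaps_around n i. p * ?y (i - d)))"
    unfolding sum_ap3_middle sum_distrib_left
    by (intro sum.cong refl) (simp add: gaps_around_def)
  finally show ?thesis
    unfolding ap3_linear_def ap_weight_def ap3_degree_def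
    by (simp only: sum.distrib sum_distrib_left of_nat_add ring_distribs ac_simps)
qed

text \<open>The degree profile is a tent. The two floors lose at most 3/2 together and the minimum
  at most 1, hence less than 3 in all.\<close>

lemma ap3_degree_bounds:
  assumes "i \<in> {1..n}"
  shows "real (ap3_degree n i) \<le> real n / 2 + min (real i) (real n - real i)"
    and "real n / 2 + min (real i) (real n - real i) - 3 \<le> real (ap3_degree n i)"
proof -
  have "2 * ((n - i) div 2 + (i - 1) div 2) \<le> n" "n \<le> 2 * ((n - i) div 2 + (i - 1) div 2) + 3"
    using assms by auto
  moreover have "min (i - 1) (n - i) \<le> min i (n - i)" "min i (n - i) \<le> min (i - 1) (n - i) + 1" by auto
  moreover have "real (min i (n - i)) = min (real i) (real n - real i)"
    using assms by (auto simp: of_nat_min of_nat_diff)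
  ultimately show "real (ap3_degree n i) \<le> real n / 2 + min (real i) (real n - real i)"
    and "real n / 2 + min (real i) (real n - real i) - 3 \<le> real (ap3_degree n i)"
    unfolding ap3_degree_def by linarith+
qed

section \<open>Gaussian tails of linear statistics\<close>

text \<open>Chernoff bound at the tilt \<open>t / v\<close>, optimal for a Gaussian of variance
  \<open>v\<close>. Small tilted weights make the logarithmic moment generating function quadratic
  up to the factor \<open>1 + \<epsilon>\<close>.\<close>

lemma linear_upper_tail:
  assumes p: "0 \<le> p" "p \<le> 1" and v: "v = p * (1 - p) * (\<Sum>i=1..n. (w i)\<^sup>2)" "0 < v"
    and t: "0 \<le> t" and bd: "\<And>i. i \<in> {1..n} \<Longrightarrow> \<bar>t / v * w i\<bar> \<le> \<epsilon>" and \<epsilon>: "0 \<le> \<epsilon>" "\<epsilon> \<le> 1"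
  shows "bprob n p (\<lambda>B. t \<le> (\<Sum>i=1..n. w i * centered p B i)) \<le> exp (- (t\<^sup>2 / v) * (1 - \<epsilon>) / 2)"
proof -
  define \<tau> where "\<tau> = t / v"
  define X where "X = (\<lambda>B. \<Sum>i=1..n. w i * centered p B i)"
  have \<tau>: "0 \<le> \<tau>" using t v by (simp add: \<tau>_def)
  have q: "\<tau> * t = t\<^sup>2 / v" "v * \<tau>\<^sup>2 = t\<^sup>2 / v"
    using v(2) by (simp_all add: \<tau>_def power2_eq_square)
  have "bexp n p (\<lambda>B. exp (\<Sum>i=1..n. (\<tau> * w i) * centered p B i))
    \<le> exp (p * (1 - p) * (1 + \<epsilon>) * (\<Sum>i=1..n. (\<tau> * w i)\<^sup>2) / 2)"
    using bd by (intro bexp_exp_linear_le p \<epsilon>) (simp add: \<tau>_def)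
  also have "p * (1 - p) * (1 + \<epsilon>) * (\<Sum>i=1..n. (\<tau> * w i)\<^sup>2) / 2 = (1 + \<epsilon>) * (v * \<tau>\<^sup>2) / 2"
    unfolding v(1) by (simp add: power_mult_distrib mult_ac flip: sum_distrib_left)
  finally have M: "bexp n p (\<lambda>B. exp (\<tau> * X B)) \<le> exp ((1 + \<epsilon>) * (t\<^sup>2 / v) / 2)"
    unfolding q by (simp add: X_def sum_distrib_left mult.assoc)
  have "bprob n p (\<lambda>B. t \<le> X B) \<le> bexp n p (\<lambda>B. exp (- \<tau> * t) * exp (\<tau> * X B))"
    unfolding bprob_eq_bexp
    by (rule bexp_mono) (use \<tau> in \<open>auto simp: mult_left_mono simp flip: exp_add\<close>)
  also have "\<dots> = exp (- \<tau> * t) * bexp n p (\<lambda>B. exp (\<tau> * X B))" by simp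
  also have "\<dots> \<le> exp (- \<tau> * t) * exp ((1 + \<epsilon>) * (t\<^sup>2 / v) / 2)"
    by (intro mult_left_mono M) simp
  also have "\<dots> = exp (- (t\<^sup>2 / v) + (1 + \<epsilon>) * (t\<^sup>2 / v) / 2)"
    using q by (simp flip: exp_add)
  also have "- (t\<^sup>2 / v) + (1 + \<epsilon>) * (t\<^sup>2 / v) / 2 = - (t\<^sup>2 / v) * (1 - \<epsilon>) / 2"
    by (simp add: algebra_simps add_divide_distrib diff_divide_distrib)
  finally show ?thesis by (simp add: X_def)
qed

text \<open>Tilt slightly too far, by \<open>(1 + \<eta>) t / v\<close>: under the tilted weight \<open>exp ((1 + \<eta>) (t / v) X)\<close> the
  mass sits in the window \<open>t \<le> X \<le> (1 + 2 \<eta>) t\<close>. The mass on either side of the window is compared with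
  the exponential moments at \<open>t / v\<close> and \<open>(1 + 2 \<eta>) t / v\<close>, which lose a factor
  \<open>exp (\<eta>\<^sup>2 t\<^sup>2 / (4 v))\<close>.\<close>

lemma linear_lower_tail:
  assumes p: "0 \<le> p" "p \<le> 1" and v: "v = p * (1 - p) * (\<Sum>i=1..n. (w i)\<^sup>2)" "0 < v"
    and t: "0 \<le> t" and \<eta>: "0 < \<eta>" "\<eta> \<le> 1"
    and bd: "\<And>i. i \<in> {1..n} \<Longrightarrow> \<bar>3 * (t / v) * w i\<bar> \<le> \<eta>\<^sup>2 / 40"
    and large: "ln 4 \<le> \<eta>\<^sup>2 * (t\<^sup>2 / v) / 4"
  shows "exp (- (t\<^sup>2 / v) * (1 / 2 + 5 * \<eta>)) \<le> bprob n p (\<lambda>B. t \<le> (\<Sum>i=1..n. w i * centered p B i))"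
proof -
  \<comment> \<open>In both side estimates the Taylor errors total at most
    \<open>8.5 * \<epsilon>\<close>, which fits into the spare
    \<open>\<eta>^2 / 4 = 10 * \<epsilon>\<close>.\<close>
  define \<epsilon> where "\<epsilon> = \<eta>\<^sup>2 / 40"
  define \<tau> where "\<tau> = t / v"
  define q where "q = t\<^sup>2 / v"
  define X where "X = (\<lambda>B. \<Sum>i=1..n. w i * centered p B i)"
  define M where "M = (\<lambda>\<theta>. bexp n p (\<lambda>B. exp (\<theta> * X B)))"
  define P where "P = bprob n p (\<lambda>B. t \<le> X B)"
  define A where "A = (1 - 2 * \<epsilon>) * (1 + \<eta>)\<^sup>2 * q / 2"
  have \<tau>: "0 \<le> \<tau>" using t v by (simp add: \<tau>_def)
  have q: "\<tau> * t = q" "v * \<tau>\<^sup>2 = q" "0 \<le> q"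
    using v(2) by (simp_all add: \<tau>_def q_def power2_eq_square)
  have \<eta>2: "0 \<le> \<eta>\<^sup>2" "\<eta>\<^sup>2 \<le> \<eta>" "\<eta>\<^sup>2 \<le> 1" using \<eta> by (auto simp: power2_eq_square mult_left_le mult_le_one)
  have \<epsilon>: "0 \<le> \<epsilon>" "\<epsilon> \<le> 1" "40 * \<epsilon> = \<eta>\<^sup>2" using \<eta>2 by (auto simp: \<epsilon>_def)
  \<comment> \<open>The range up to 3 covers the three tilts 1, \<open>1 + \<eta>\<close> and
    \<open>1 + 2 * \<eta>\<close>, in units of \<tau>.\<close>
  have bd': "\<bar>c * \<tau> * w i\<bar> \<le> \<epsilon>" if "i \<in> {1..n}" "0 \<le> c" "c \<le> 3" for i c
  proof -
    have "\<bar>c * \<tau> * w i\<bar> \<le> 3 * \<tau> * \<bar>w i\<bar>"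
      using that \<tau> by (simp add: abs_mult mult_right_mono)
    also have "\<dots> \<le> \<epsilon>" using bd[OF that(1)] \<tau> by (simp add: \<epsilon>_def abs_mult flip: \<tau>_def)
    finally show ?thesis .
  qed
  have sq: "p * (1 - p) * d * (\<Sum>i=1..n. (c * \<tau> * w i)\<^sup>2) / 2 = d * c\<^sup>2 * q / 2" for c d
    unfolding q(2)[symmetric] v(1) by (simp add: power_mult_distrib mult_ac flip: sum_distrib_left)
  have Mx: "bexp n p (\<lambda>B. exp (\<Sum>i=1..n. (c * \<tau> * w i) * centered p B i)) = M (c * \<tau>)" for c
    by (simp add: M_def X_def sum_distrib_left mult.assoc)
  have M_le: "M (c * \<tau>) \<le> exp ((1 + \<epsilon>) * c\<^sup>2 * q / 2)" if "0 \<le> c" "c \<le> 3" for c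
    using bexp_exp_linear_le[where w = "\<lambda>i. c * \<tau> * w i" and n = n, OF p bd'[OF _ that] \<epsilon>(1,2)] unfolding sq Mx by simp
  have M_ge: "exp ((1 - 2 * \<epsilon>) * c\<^sup>2 * q / 2) \<le> M (c * \<tau>)" if "0 \<le> c" "c \<le> 3" for c
    using bexp_exp_linear_ge[where w = "\<lambda>i. c * \<tau> * w i" and n = n, OF p bd'[OF _ that] \<epsilon>(2)] unfolding sq Mx by simp
  \<comment> \<open>The three terms dominate, in order, the window, the region below it and the
    region above it.\<close>
  have pt: "exp ((1 + \<eta>) * \<tau> * X B) \<le> exp ((1 + \<eta>) * (1 + 2 * \<eta>) * q) * of_bool (t \<le> X B)
      + exp (\<eta> * q) * exp (1 * \<tau> * X B)
      + exp (- \<eta> * (1 + 2 * \<eta>) * q) * exp ((1 + 2 * \<eta>) * \<tau> * X B)" (is "?L \<le> ?a + ?b + ?c") for B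
  proof -
    have nn: "0 \<le> ?a" "0 \<le> ?b" "0 \<le> ?c" by auto
    consider "X B < t" | "t \<le> X B" "X B \<le> (1 + 2 * \<eta>) * t" | "(1 + 2 * \<eta>) * t < X B" by linarith
    then show ?thesis
    proof cases
      case 1
      have "(\<eta> * \<tau>) * X B \<le> (\<eta> * \<tau>) * t" using 1 \<tau> \<eta> by (intro mult_left_mono) auto
      then have "(1 + \<eta>) * \<tau> * X B \<le> \<eta> * q + 1 * \<tau> * X B"
        unfolding q(1)[symmetric] by (simp add: algebra_simps)
      then have "?L \<le> ?b" by (simp flip: exp_add)
      then show ?thesis using nn by linarith
    next
      case 2
      have "((1 + \<eta>) * \<tau>) * X B \<le> ((1 + \<eta>) * \<tau>) * ((1 + 2 * \<eta>) * t)" using 2 \<tau> \<eta> by (intro mult_left_mono) auto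
      then have "?L \<le> ?a"
        using 2 unfolding q(1)[symmetric] by (simp add: mult_ac)
      then show ?thesis using nn by linarith
    next
      case 3
      have "(\<eta> * \<tau>) * ((1 + 2 * \<eta>) * t) \<le> (\<eta> * \<tau>) * X B" using 3 \<tau> \<eta> by (intro mult_left_mono) auto
      then have "(1 + \<eta>) * \<tau> * X B \<le> - \<eta> * (1 + 2 * \<eta>) * q + (1 + 2 * \<eta>) * \<tau> * X B"
        unfolding q(1)[symmetric] by (simp add: algebra_simps)
      then have "?L \<le> ?c" by (simp only: exp_add[symmetric] exp_le_cancel_iff)
      then show ?thesis using nn by linarith
    qed
  qed
  have "exp A \<le> M ((1 + \<eta>) * \<tau>)" unfolding A_def using \<eta> by (intro M_ge) auto
  also have "\<dots> \<le> bexp n p (\<lambda>B. exp ((1 + \<eta>) * (1 + 2 * \<eta>) * q) * of_bool (t \<le> X B)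
      + exp (\<eta> * q) * exp (1 * \<tau> * X B)
      + exp (- \<eta> * (1 + 2 * \<eta>) * q) * exp ((1 + 2 * \<eta>) * \<tau> * X B))"
    unfolding M_def by (rule bexp_mono) (rule pt)
  also have "\<dots> = exp ((1 + \<eta>) * (1 + 2 * \<eta>) * q) * P + exp (\<eta> * q) * M (1 * \<tau>)
      + exp (- \<eta> * (1 + 2 * \<eta>) * q) * M ((1 + 2 * \<eta>) * \<tau>)"
    unfolding P_def bprob_eq_bexp M_def by simp
  finally have main: "exp A \<le> \<dots>" .
  define x y where "x = \<epsilon> * (1 + \<eta>)\<^sup>2" and "y = \<epsilon> * (1 + 2 * \<eta>)\<^sup>2"
  have "(1 + \<eta>)\<^sup>2 \<le> 2\<^sup>2" "(1 + 2 * \<eta>)\<^sup>2 \<le> 3\<^sup>2" using \<eta> by (intro power_mono; simp)+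
  then have "x \<le> \<epsilon> * 2\<^sup>2" "y \<le> \<epsilon> * 3\<^sup>2"
    unfolding x_def y_def using \<epsilon> by (intro mult_left_mono; simp)+
  then have xy: "x \<le> 4 * \<epsilon>" "y \<le> 9 * \<epsilon>" by simp_all
  have expand: "(1 - 2 * \<epsilon>) * (1 + \<eta>)\<^sup>2 / 2 = 1 / 2 + \<eta> + \<eta>\<^sup>2 / 2 - x"
    "(1 + \<epsilon>) * (1 + 2 * \<eta>)\<^sup>2 / 2 = 1 / 2 + 2 * \<eta> + 2 * \<eta>\<^sup>2 + y / 2"
    "(1 + \<eta>) * (1 + 2 * \<eta>) = 1 + 3 * \<eta> + 2 * \<eta>\<^sup>2"
    "- \<eta> * (1 + 2 * \<eta>) = - \<eta> - 2 * \<eta>\<^sup>2"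
    by (simp_all add: x_def y_def power2_eq_square field_simps)
  \<comment> \<open>The spare exponent beats \<open>ln 4\<close>. Each side of the window then
    carries at most a quarter of \<open>exp A\<close>, leaving at least half for the window.\<close>
  have quarter: "exp (A - \<eta>\<^sup>2 * q / 4) \<le> exp A / 4"
  proof -
    have "A - \<eta>\<^sup>2 * q / 4 \<le> A - ln 4" using large by (simp add: q_def)
    then have "exp (A - \<eta>\<^sup>2 * q / 4) \<le> exp (A - ln 4)" by simp
    then show ?thesis by (simp add: exp_diff)
  qed
  have "exp (\<eta> * q) * M (1 * \<tau>) \<le> exp (\<eta> * q) * exp ((1 + \<epsilon>) * 1\<^sup>2 * q / 2)"
    by (intro mult_left_mono M_le) auto
  also have "\<dots> \<le> exp (A - \<eta>\<^sup>2 * q / 4)"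
  proof -
    have "\<eta> + (1 + \<epsilon>) / 2 \<le> (1 - 2 * \<epsilon>) * (1 + \<eta>)\<^sup>2 / 2 - \<eta>\<^sup>2 / 4"
      using xy \<epsilon> unfolding expand by argo
    then have "(\<eta> + (1 + \<epsilon>) / 2) * q \<le> ((1 - 2 * \<epsilon>) * (1 + \<eta>)\<^sup>2 / 2 - \<eta>\<^sup>2 / 4) * q"
      using q(3) by (rule mult_right_mono)
    then have "\<eta> * q + (1 + \<epsilon>) * 1\<^sup>2 * q / 2 \<le> A - \<eta>\<^sup>2 * q / 4"
      by (simp add: A_def left_diff_distrib distrib_right)
    then show ?thesis by (simp only: exp_add[symmetric] exp_le_cancel_iff)
  qed
  finally have b1: "exp (\<eta> * q) * M (1 * \<tau>) \<le> exp A / 4" using quarter by linarith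
  have "exp (- \<eta> * (1 + 2 * \<eta>) * q) * M ((1 + 2 * \<eta>) * \<tau>)
      \<le> exp (- \<eta> * (1 + 2 * \<eta>) * q) * exp ((1 + \<epsilon>) * (1 + 2 * \<eta>)\<^sup>2 * q / 2)"
    using \<eta> by (intro mult_left_mono M_le) auto
  also have "\<dots> \<le> exp (A - \<eta>\<^sup>2 * q / 4)"
  proof -
    have "- \<eta> * (1 + 2 * \<eta>) + (1 + \<epsilon>) * (1 + 2 * \<eta>)\<^sup>2 / 2
        \<le> (1 - 2 * \<epsilon>) * (1 + \<eta>)\<^sup>2 / 2 - \<eta>\<^sup>2 / 4"
      using xy \<epsilon> unfolding expand by argo
    then have "(- \<eta> * (1 + 2 * \<eta>) + (1 + \<epsilon>) * (1 + 2 * \<eta>)\<^sup>2 / 2) * q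
        \<le> ((1 - 2 * \<epsilon>) * (1 + \<eta>)\<^sup>2 / 2 - \<eta>\<^sup>2 / 4) * q"
      using q(3) by (rule mult_right_mono)
    then have "- \<eta> * (1 + 2 * \<eta>) * q + (1 + \<epsilon>) * (1 + 2 * \<eta>)\<^sup>2 * q / 2 \<le> A - \<eta>\<^sup>2 * q / 4"
      by (simp add: A_def left_diff_distrib distrib_right)
    then show ?thesis by (simp only: exp_add[symmetric] exp_le_cancel_iff)
  qed
  finally have b2: "exp (- \<eta> * (1 + 2 * \<eta>) * q) * M ((1 + 2 * \<eta>) * \<tau>) \<le> exp A / 4"
    using quarter by linarith
  have "exp A / 2 \<le> exp ((1 + \<eta>) * (1 + 2 * \<eta>) * q) * P"
    using main b1 b2 by linarith
  then have P: "exp A * (1 / 2) \<le> exp ((1 + \<eta>) * (1 + 2 * \<eta>) * q) * P" by simp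
  \<comment> \<open>The losses are \<open>2 * \<eta>\<close> plus less than
    \<open>2 * \<eta>^2\<close>, below \<open>5 * \<eta>\<close>. Using \<open>ln 4\<close> where
    \<open>ln 2\<close> would do lets \<open>large\<close> be reused.\<close>
  have "- q * (1 / 2 + 5 * \<eta>) \<le> A - ln 4 - (1 + \<eta>) * (1 + 2 * \<eta>) * q"
  proof -
    have "- (1 / 2 + 5 * \<eta>) \<le> (1 - 2 * \<epsilon>) * (1 + \<eta>)\<^sup>2 / 2 - \<eta>\<^sup>2 / 4 - (1 + \<eta>) * (1 + 2 * \<eta>)"
      using xy \<epsilon> \<eta>2 \<eta> unfolding expand by argo
    then have "- (1 / 2 + 5 * \<eta>) * q \<le> ((1 - 2 * \<epsilon>) * (1 + \<eta>)\<^sup>2 / 2 - \<eta>\<^sup>2 / 4 - (1 + \<eta>) * (1 + 2 * \<eta>)) * q"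
      using q(3) by (rule mult_right_mono)
    then have "- q * (1 / 2 + 5 * \<eta>) \<le> A - \<eta>\<^sup>2 * q / 4 - (1 + \<eta>) * (1 + 2 * \<eta>) * q"
      by (simp add: A_def algebra_simps)
    then show ?thesis using large by (simp add: q_def)
  qed
  then have "exp (- q * (1 / 2 + 5 * \<eta>)) \<le> exp (A - ln 4 - (1 + \<eta>) * (1 + 2 * \<eta>) * q)" by simp
  also have "\<dots> = exp A * (1 / 4) / exp ((1 + \<eta>) * (1 + 2 * \<eta>) * q)"
    by (simp add: exp_diff)
  also have "\<dots> \<le> exp A * (1 / 2) / exp ((1 + \<eta>) * (1 + 2 * \<eta>) * q)"
    by (intro divide_right_mono mult_left_mono) auto
  also have "\<dots> \<le> P" using P by (simp add: pos_divide_le_eq mult.commute)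
  finally show ?thesis by (simp add: P_def X_def q_def)
qed

section \<open>The sum of squared degrees\<close>

lemma sum_shifted_squares:
  "(\<Sum>i=1..m. (c + real i)\<^sup>2) = m * c\<^sup>2 + c * m * (m + 1) + m * (m + 1) * (2 * m + 1) / 6"
  by (induction m) (simp_all add: power2_eq_square field_simps)

lemma sum_shifted_squares':
  "(\<Sum>j<k. (c + real j)\<^sup>2) = k * c\<^sup>2 + c * k * (real k - 1) + k * (real k - 1) * (2 * real k - 1) / 6"
  by (induction k) (simp_all add: power2_eq_square field_simps)

text \<open>Cuts the tent at its peak. The reflection \<open>i\<close> to \<open>n - i\<close> sends
  the last index to 0, so the right half runs from 0 and the left half from 1.\<close>

lemma sum_tent_squares:
  fixes n :: nat and c :: real
  defines "m \<equiv> n div 2"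
  shows "(\<Sum>i=1..n. (c + min (real i) (real n - real i))\<^sup>2) =
    (\<Sum>i=1..m. (c + real i)\<^sup>2) + (\<Sum>j<n - m. (c + real j)\<^sup>2)"
proof -
  have "{1..n} = {1..m} \<union> {m+1..n}" by (auto simp: m_def)
  then have "(\<Sum>i=1..n. (c + min (real i) (real n - real i))\<^sup>2) =
     (\<Sum>i=1..m. (c + min (real i) (real n - real i))\<^sup>2) + (\<Sum>i=m+1..n. (c + min (real i) (real n - real i))\<^sup>2)"
    by (simp only:) (rule sum.union_disjoint, auto)
  also have "(\<Sum>i=1..m. (c + min (real i) (real n - real i))\<^sup>2) = (\<Sum>i=1..m. (c + real i)\<^sup>2)"
  proof (intro sum.cong refl)
    fix i assume "i \<in> {1..m}"
    then have "2 * i \<le> n" by (auto simp: m_def)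
    then have "min (real i) (real n - real i) = real i" by linarith
    then show "(c + min (real i) (real n - real i))\<^sup>2 = (c + real i)\<^sup>2" by simp
  qed
  also have "(\<Sum>i=m+1..n. (c + min (real i) (real n - real i))\<^sup>2) = (\<Sum>j<n - m. (c + real j)\<^sup>2)"
  proof (rule sum.reindex_bij_witness[of _ "\<lambda>j. n - j" "\<lambda>i. n - i"])
    fix i assume "i \<in> {m+1..n}"
    then have "n \<le> 2 * i" "i \<le> n" by (auto simp: m_def)
    then have "min (real i) (real n - real i) = real (n - i)" by linarith
    then show "(c + real (n - i))\<^sup>2 = (c + min (real i) (real n - real i))\<^sup>2" by simp
  qed (auto simp: m_def)
  finally show ?thesis .
qed

definition ap3_degree_sq :: "nat \<Rightarrow> real" where
  "ap3_degree_sq n = (\<Sum>i=1..n. (real (ap3_degree n i))\<^sup>2)"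

text \<open>The limit is twice the integral of \<open>(1/2 + x)^2\<close> over [0, 1/2], that is 2 *
  7/24; it is obtained here from closed forms.\<close>

lemma tent_squares_asymp:
  "(\<lambda>n. (\<Sum>i=1..n. (real n / 2 + min (real i) (real n - real i))\<^sup>2) / real n ^ 3) \<longlonglongrightarrow> 7 / 12"
proof -
  define u where "u = (\<lambda>n. real (n div 2) / real n)"
  define v where "v = (\<lambda>n. real (n - n div 2) / real n)"
  define e where "e = (\<lambda>n::nat. 1 / real n)"
  have e: "e \<longlonglongrightarrow> 0" unfolding e_def by (rule lim_1_over_n)
  have hb: "1 / 2 - e n \<le> u n" "u n \<le> 1 / 2" "1 / 2 \<le> v n" "v n \<le> 1 / 2 + e n" if "n > 0" for n
  proof -
    have "(real n / 2 - 1) / real n \<le> u n" "u n \<le> (real n / 2) / real n"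
      "(real n / 2) / real n \<le> v n" "v n \<le> (real n / 2 + 1) / real n"
      unfolding u_def v_def by (intro divide_right_mono; linarith)+
    then show "1 / 2 - e n \<le> u n" "u n \<le> 1 / 2" "1 / 2 \<le> v n" "v n \<le> 1 / 2 + e n"
      using that by (simp_all add: e_def add_divide_distrib diff_divide_distrib)
  qed
  have u: "u \<longlonglongrightarrow> 1 / 2"
  proof (rule tendsto_sandwich[OF _ _ _ tendsto_const])
    show "(\<lambda>n. 1 / 2 - e n) \<longlonglongrightarrow> 1 / 2" using tendsto_diff[OF tendsto_const e] by simp
  qed (use hb in \<open>auto intro: eventually_sequentiallyI[of 1]\<close>)
  have v: "v \<longlonglongrightarrow> 1 / 2"
  proof (rule tendsto_sandwich[OF _ _ tendsto_const])
    show "(\<lambda>n. 1 / 2 + e n) \<longlonglongrightarrow> 1 / 2" using tendsto_add[OF tendsto_const e] by simp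
  qed (use hb in \<open>auto intro: eventually_sequentiallyI[of 1]\<close>)
  \<comment> \<open>The closed forms divided by the cube of \<open>n\<close>, written in the
    relative sizes \<open>u\<close>, \<open>v\<close> of the halves and \<open>e = 1 / n\<close>;
    the limit is then a substitution.\<close>
  define f where "f = (\<lambda>n. u n / 4 + u n * (u n + e n) / 2 + u n * (u n + e n) * (2 * u n + e n) / 6
      + (v n / 4 + v n * (v n - e n) / 2 + v n * (v n - e n) * (2 * v n - e n) / 6))"
  have "f \<longlonglongrightarrow> 7 / 12"
    unfolding f_def by (rule tendsto_eq_intros u v e refl | simp)+
  moreover have "f n = (\<Sum>i=1..n. (real n / 2 + min (real i) (real n - real i))\<^sup>2) / real n ^ 3" if "n \<ge> 1" for n
  proof -
    have *: "real (n div 2) = u n * n" "real (n - n div 2) = v n * n" "1 = e n * n"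
      using that by (auto simp: u_def v_def e_def)
    show ?thesis
      unfolding sum_tent_squares sum_shifted_squares sum_shifted_squares' of_nat_add of_nat_mult of_nat_numeral of_nat_1 *(1,2)
      using that by (simp add: f_def e_def power2_eq_square power3_eq_cube field_simps)
  qed
  then have "\<forall>\<^sub>F n in sequentially. f n =
      (\<Sum>i=1..n. (real n / 2 + min (real i) (real n - real i))\<^sup>2) / real n ^ 3"
    by (rule eventually_sequentiallyI)
  ultimately show ?thesis by (rule Lim_transform_eventually)
qed

lemma ap3_degree_le: "i \<in> {1..n} \<Longrightarrow> real (ap3_degree n i) \<le> real n"
  using ap3_degree_bounds(1)[of i n] by linarith

text \<open>Degrees differ from the tent by at most 3 and both are at most \<open>n\<close>, so each
  square changes by at most \<open>6 * n\<close>, negligible after division by the cube.\<close>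

lemma ap3_degree_sq_asymp: "(\<lambda>n. ap3_degree_sq n / real n ^ 3) \<longlonglongrightarrow> 7 / 12"
proof -
  define T where "T = (\<lambda>n. \<Sum>i=1..n. (real n / 2 + min (real i) (real n - real i))\<^sup>2)"
  have bounds: "ap3_degree_sq n \<le> T n \<and> T n - 6 * real n ^ 2 \<le> ap3_degree_sq n" for n
  proof -
    have "(real (ap3_degree n i))\<^sup>2 \<le> (real n / 2 + min (real i) (real n - real i))\<^sup>2 \<and>
        (real n / 2 + min (real i) (real n - real i))\<^sup>2 - 6 * real n \<le> (real (ap3_degree n i))\<^sup>2"
      if i: "i \<in> {1..n}" for i
    proof -
      define d g where "d = real (ap3_degree n i)" and "g = real n / 2 + min (real i) (real n - real i)"
      have dg: "0 \<le> d" "d \<le> g" "g \<le> d + 3" "g \<le> n"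
        using ap3_degree_bounds[OF i] by (auto simp: d_def g_def)
      have "d\<^sup>2 \<le> g\<^sup>2" using dg by (intro power_mono) auto
      moreover have "(g - d) * (g + d) \<le> 3 * (2 * real n)" using dg by (intro mult_mono) auto
      then have "g\<^sup>2 - 6 * real n \<le> d\<^sup>2" by (simp add: power2_eq_square algebra_simps)
      ultimately show ?thesis by (simp add: d_def g_def)
    qed
    then have "ap3_degree_sq n \<le> T n"
      "(\<Sum>i=1..n. (real n / 2 + min (real i) (real n - real i))\<^sup>2 - 6 * real n) \<le> ap3_degree_sq n"
      unfolding ap3_degree_sq_def T_def by (auto intro!: sum_mono)
    then show ?thesis by (simp add: sum_subtractf T_def power2_eq_square)
  qed
  have T: "(\<lambda>n. T n / real n ^ 3) \<longlonglongrightarrow> 7 / 12" unfolding T_def by (rule tent_squares_asymp)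
  show ?thesis
  proof (rule tendsto_sandwich[OF _ _ _ T])
    have "(\<lambda>n. T n / real n ^ 3 - 6 * (1 / real n)) \<longlonglongrightarrow> 7 / 12 - 6 * 0"
      by (intro tendsto_intros T lim_1_over_n)
    then show "(\<lambda>n. T n / real n ^ 3 - 6 * (1 / real n)) \<longlonglongrightarrow> 7 / 12" by simp
    show "\<forall>\<^sub>F n in sequentially. T n / real n ^ 3 - 6 * (1 / real n) \<le> ap3_degree_sq n / real n ^ 3"
    proof (rule eventually_sequentiallyI[of 1])
      fix n :: nat assume "1 \<le> n"
      then have "T n / real n ^ 3 - 6 * (1 / real n) = (T n - 6 * real n ^ 2) / real n ^ 3"
        by (simp add: field_simps power2_eq_square power3_eq_cube)
      then show "T n / real n ^ 3 - 6 * (1 / real n) \<le> ap3_degree_sq n / real n ^ 3"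
        using bounds by (simp add: divide_right_mono)
    qed
    show "\<forall>\<^sub>F n in sequentially. ap3_degree_sq n / real n ^ 3 \<le> T n / real n ^ 3"
      using bounds by (simp add: divide_right_mono)
  qed
qed

section \<open>Asymptotics\<close>

locale moderate_deviation =
  fixes p \<delta> :: "nat \<Rightarrow> real"
  assumes p_range: "N \<ge> 1 \<Longrightarrow> 0 < p N \<and> p N < 1 / 2"
    and \<delta>_pos: "\<forall>\<^sub>F N in sequentially. \<delta> N > 0"
    and \<delta>_lower: "(\<lambda>N. sqrt (ln (real N) / (p N * real N)) / \<delta> N) \<longlonglongrightarrow> 0"
    and \<delta>_upper: "(\<lambda>N. \<delta> N / sqrt (p N)) \<longlonglongrightarrow> 0"
begin

text \<open>The order of the exponent. Its refinement \<open>rate\<close> carries the exact variance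
  factor and agrees with it up to a factor 2.\<close>

definition speed :: "nat \<Rightarrow> real" where
  "speed N = \<delta> N ^ 2 * p N * real N"

definition rate :: "nat \<Rightarrow> real" where
  "rate N = speed N / (1 - p N)"

definition threshold :: "nat \<Rightarrow> real" where
  "threshold N = \<delta> N * p N ^ 3 * real N ^ 2 / 4"

section \<open>Scaling consequences of the bounds on \<delta>\<close>

lemma eventually_basic: "\<forall>\<^sub>F N in sequentially. N \<ge> 1 \<and> 0 < p N \<and> p N < 1 / 2 \<and> 0 < \<delta> N"
  using \<delta>_pos eventually_ge_at_top[of 1] by eventually_elim (use p_range in auto)

lemma \<delta>_tendsto_0: "\<delta> \<longlonglongrightarrow> 0"
proof (rule tendsto_sandwich[OF _ _ tendsto_const \<delta>_upper])
  show "\<forall>\<^sub>F N in sequentially. 0 \<le> \<delta> N"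
    using eventually_basic by eventually_elim auto
  show "\<forall>\<^sub>F N in sequentially. \<delta> N \<le> \<delta> N / sqrt (p N)"
    using eventually_basic
  proof eventually_elim
    case (elim N)
    then have "\<delta> N * sqrt (p N) \<le> \<delta> N * 1" by (intro mult_left_mono) auto
    then show ?case using elim by (simp add: pos_le_divide_eq)
  qed
qed

text \<open>The square of the upper hypothesis on \<delta>. It makes the exceptional event of large
  coefficients negligible at the scale \<open>speed\<close>.\<close>

lemma speed_over_tendsto_0: "(\<lambda>N. speed N / (p N ^ 2 * real N)) \<longlonglongrightarrow> 0"
proof (rule Lim_transform_eventually)
  show "(\<lambda>N. (\<delta> N / sqrt (p N))\<^sup>2) \<longlonglongrightarrow> 0"
    using tendsto_power[OF \<delta>_upper, of 2] by simp
  show "\<forall>\<^sub>F N in sequentially. (\<delta> N / sqrt (p N))\<^sup>2 = speed N / (p N ^ 2 * real N)"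
    using eventually_basic
    by eventually_elim (simp add: speed_def power_divide power2_eq_square[of "p _"])
qed

text \<open>The square of the lower hypothesis on \<delta>. It absorbs the factor \<open>N\<close>
  of the union bound over vertices.\<close>

lemma ln_over_speed_tendsto_0: "(\<lambda>N. ln (real N) / speed N) \<longlonglongrightarrow> 0"
proof (rule Lim_transform_eventually)
  show "(\<lambda>N. (sqrt (ln (real N) / (p N * real N)) / \<delta> N)\<^sup>2) \<longlonglongrightarrow> 0"
    using tendsto_power[OF \<delta>_lower, of 2] by simp
  show "\<forall>\<^sub>F N in sequentially. (sqrt (ln (real N) / (p N * real N)) / \<delta> N)\<^sup>2 = ln (real N) / speed N"
    using eventually_basic
    by eventually_elim (simp add: speed_def power_divide mult_ac)
qed

lemma eventually_ln_le_speed: "\<forall>\<^sub>F N in sequentially. ln (real N) \<le> speed N"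
  using order_tendstoD(2)[OF ln_over_speed_tendsto_0, of 1, simplified] eventually_basic
proof eventually_elim
  case (elim N)
  then have "0 < speed N" by (simp add: speed_def)
  then show ?case using elim by (simp add: field_simps)
qed

lemma speed_at_top: "filterlim speed at_top sequentially"
  by (rule filterlim_at_top_mono[OF _ eventually_ln_le_speed])
    (rule filterlim_compose[OF ln_at_top filterlim_real_sequentially])

lemma eventually_rate_bounds:
  "\<forall>\<^sub>F N in sequentially. speed N \<le> rate N \<and> rate N \<le> 2 * speed N"
  using eventually_basic
proof eventually_elim
  case (elim N)
  then have "0 \<le> speed N" by (simp add: speed_def)
  then have "speed N * (1 - p N) \<le> speed N * 1" "speed N * (1 / 2) \<le> speed N * (1 - p N)"
    using elim by (intro mult_left_mono; simp)+
  then show ?case using elim by (simp add: rate_def field_simps)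
qed

lemma rate_at_top: "filterlim rate at_top sequentially"
  by (rule filterlim_at_top_mono[OF speed_at_top])
    (use eventually_rate_bounds in eventually_elim, simp)

lemma remainder_negligible:
  assumes K: "0 < K" and \<rho>: "0 < \<rho>"
  shows "\<forall>\<^sub>F N in sequentially.
    bprob N (p N) (\<lambda>B. \<rho> * threshold N \<le> \<bar>\<Sum>i=1..N. centered (p N) B i * ap_weight N (p N) i B\<bar>)
      \<le> exp (- K * speed N)"
proof -
  \<comment> \<open>Small enough that Freedman's exponent
    \<open>\<rho>^2 / (64 * \<gamma>^2)\<close> is at least \<open>K + 1\<close>.\<close>
  define \<gamma> where "\<gamma> = min 1 (\<rho> / (8 * (K + 1)))"
  have \<gamma>: "0 < \<gamma>" "\<gamma> \<le> 1" using K \<rho> by (auto simp: \<gamma>_def)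
  have "\<gamma> * (8 * (K + 1)) \<le> \<rho>"
    using K by (simp add: \<gamma>_def min_def pos_le_divide_eq not_le split: if_splits)
  then have "(\<gamma> * (8 * (K + 1)))\<^sup>2 \<le> \<rho>\<^sup>2" using \<gamma> K by (intro power_mono) auto
  moreover have "(\<gamma> * 8)\<^sup>2 * (K + 1) * 1 \<le> (\<gamma> * 8)\<^sup>2 * (K + 1) * (K + 1)"
    using K by (intro mult_left_mono) auto
  moreover have "(\<gamma> * (8 * (K + 1)))\<^sup>2 = (\<gamma> * 8)\<^sup>2 * (K + 1) * (K + 1)"
    "64 * \<gamma>\<^sup>2 * (K + 1) = (\<gamma> * 8)\<^sup>2 * (K + 1) * 1"
    by (simp_all add: power2_eq_square algebra_simps)
  ultimately have "64 * \<gamma>\<^sup>2 * (K + 1) \<le> \<rho>\<^sup>2" by linarith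
  then have \<gamma>K: "K + 1 \<le> \<rho>\<^sup>2 / (64 * \<gamma>\<^sup>2)" using \<gamma> by (simp add: pos_le_divide_eq mult_ac)
  \<comment> \<open>Of the surplus in \<open>K + 2\<close>, one \<open>speed N\<close> absorbs the
    factor \<open>N\<close> and the other the constant 11 = 9 + 2.\<close>
  have "0 < \<gamma>\<^sup>2 / (192 * (K + 2))" using \<gamma> K by simp
  note ev1 = order_tendstoD(2)[OF speed_over_tendsto_0 this]
  have "0 < 8 * \<gamma> / \<rho>" using \<gamma> \<rho> by simp
  note ev2 = order_tendstoD(2)[OF \<delta>_tendsto_0 this]
  have ev3: "\<forall>\<^sub>F N in sequentially. ln 11 \<le> speed N"
    using speed_at_top by (simp add: filterlim_at_top)
  show ?thesis
    using eventually_basic eventually_ln_le_speed ev1 ev2 ev3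
  proof eventually_elim
    case (elim N)
    define P D n s where "P = p N" and "D = \<delta> N" and "n = real N" and "s = speed N"
    have P: "0 < P" "P \<le> 1" "0 < D" "1 \<le> n" using elim by (auto simp: P_def D_def n_def)
    have s: "s = D\<^sup>2 * P * n" by (simp add: s_def speed_def P_def D_def n_def)
    \<comment> \<open>The minimiser of Freedman's exponent; it is admissible eventually because
      \<delta> tends to 0.\<close>
    define \<theta> where "\<theta> = \<rho> * D / (8 * \<gamma>\<^sup>2 * P\<^sup>2 * n)"
    have "\<theta> * (\<gamma> * P\<^sup>2 * n) = \<rho> * D / (8 * \<gamma>)"
      using P \<gamma> by (simp add: \<theta>_def power2_eq_square)
    also have "\<dots> \<le> 1" using elim \<rho> \<gamma> by (simp add: D_def field_simps)
    finally have th: "0 \<le> \<theta>" "\<theta> * (\<gamma> * P\<^sup>2 * n) \<le> 1" using \<rho> P by (auto simp: \<theta>_def)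
    have expo: "- \<theta> * (\<rho> * threshold N) + \<theta>\<^sup>2 * P * (n * (\<gamma> * P\<^sup>2 * n)\<^sup>2) = - (\<rho>\<^sup>2 / (64 * \<gamma>\<^sup>2) * s)"
      unfolding s threshold_def P_def[symmetric] D_def[symmetric] n_def[symmetric] \<theta>_def
      using P \<gamma> by (simp add: power2_eq_square power3_eq_cube field_simps)
    have "\<rho>\<^sup>2 / (64 * \<gamma>\<^sup>2) * s \<ge> (K + 1) * s"
      using \<gamma>K P by (intro mult_right_mono) (auto simp: s)
    then have e2: "exp (- (\<rho>\<^sup>2 / (64 * \<gamma>\<^sup>2) * s)) \<le> exp (- ((K + 1) * s))" by simp
    have "s < \<gamma>\<^sup>2 / (192 * (K + 2)) * (P\<^sup>2 * n)"
      using elim P by (simp add: pos_divide_less_eq s_def P_def n_def)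
    then have "s * (192 * (K + 2)) < \<gamma>\<^sup>2 / (192 * (K + 2)) * (P\<^sup>2 * n) * (192 * (K + 2))"
      using K by (intro mult_strict_right_mono) auto
    then have "(K + 2) * s \<le> \<gamma>\<^sup>2 * P\<^sup>2 * n / 192" using K by (simp add: mult_ac)
    then have "exp (- (\<gamma>\<^sup>2 * P\<^sup>2 * n / 192)) \<le> exp (- ((K + 2) * s))" by simp
    moreover have "exp (ln n) \<le> exp s" using elim by (simp only: exp_le_cancel_iff s_def n_def)
    then have "n \<le> exp s" using P by simp
    ultimately have "n * exp (- (\<gamma>\<^sup>2 * P\<^sup>2 * n / 192)) \<le> exp s * exp (- ((K + 2) * s))"
      by (intro mult_mono) auto
    also have "\<dots> = exp (s + - ((K + 2) * s))" by (simp only: exp_add)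
    also have "s + - ((K + 2) * s) = - ((K + 1) * s)" by (simp add: algebra_simps)
    finally have e1: "n * exp (- (\<gamma>\<^sup>2 * P\<^sup>2 * n / 192)) \<le> exp (- ((K + 1) * s))" .
    have "bprob N P (\<lambda>B. \<rho> * threshold N \<le> \<bar>\<Sum>i=1..N. centered P B i * ap_weight N P i B\<bar>)
      \<le> 9 * n * exp (- (\<gamma>\<^sup>2 * P\<^sup>2 * n / 192)) + 2 * exp (- (\<rho>\<^sup>2 / (64 * \<gamma>\<^sup>2) * s))"
      using remainder_tail[OF P(1,2) \<gamma> th[unfolded n_def], of "\<rho> * threshold N"] expo
      by (simp add: n_def)
    also have "\<dots> \<le> 11 * exp (- ((K + 1) * s))" using e1 e2 by linarith
    also have "\<dots> = exp (ln 11 - (K + 1) * s)"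
      by (simp only: exp_diff exp_minus divide_inverse) simp
    also have "\<dots> \<le> exp (- K * s)" using elim by (simp add: s_def algebra_simps)
    finally show ?case by (simp add: P_def s_def)
  qed
qed

section \<open>The linear part at the scale of the threshold\<close>

definition deg_ratio :: "nat \<Rightarrow> real" where
  "deg_ratio N = real N ^ 3 / (16 * ap3_degree_sq N)"

text \<open>The 16 is the square of the 4 in \<open>threshold\<close>, and 7/12 is the degree limit.
  Half of 3/28, from the Gaussian exponent, is the final 3/56.\<close>

lemma deg_ratio_tendsto: "deg_ratio \<longlonglongrightarrow> 3 / 28"
proof -
  have "(\<lambda>N. 1 / (16 * (ap3_degree_sq N / real N ^ 3))) \<longlonglongrightarrow> 1 / (16 * (7 / 12))"
    by (intro tendsto_intros ap3_degree_sq_asymp) simp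
  then show ?thesis by (simp add: deg_ratio_def[abs_def])
qed

text \<open>Input for the Gaussian tail bounds. The tilted weights are of order \<delta>, since
  degrees are at most \<open>N\<close> and \<open>1 / (1 - p N)\<close> is at most 2.\<close>

lemma ap3_linear_normalization:
  assumes N: "N \<ge> 1" "ap3_degree_sq N > 0" "0 < \<delta> N" and c: "0 \<le> c"
  defines "v \<equiv> p N * (1 - p N) * ap3_degree_sq N"
  defines "t \<equiv> c * threshold N / p N ^ 2"
  shows "0 < v" "0 \<le> t" "t\<^sup>2 / v = c\<^sup>2 * deg_ratio N * rate N"
    "i \<in> {1..N} \<Longrightarrow> \<bar>t / v * real (ap3_degree N i)\<bar> \<le> 8 * c * \<delta> N * deg_ratio N"
proof -
  have p: "0 < p N" "p N < 1 / 2" using p_range[OF N(1)] by auto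
  show v: "0 < v" using p N by (simp add: v_def)
  show t: "0 \<le> t" using p N c by (simp add: t_def threshold_def)
  define S where "S = ap3_degree_sq N"
  define a where "a = 1 - p N"
  have S: "0 < S" and a: "0 < a" "1 / 2 \<le> a" using N p by (auto simp: S_def a_def)
  show "t\<^sup>2 / v = c\<^sup>2 * deg_ratio N * rate N"
    unfolding t_def v_def threshold_def deg_ratio_def rate_def speed_def S_def[symmetric] a_def[symmetric]
    using p S a by (simp add: power2_eq_square power3_eq_cube field_simps)
  show "\<bar>t / v * real (ap3_degree N i)\<bar> \<le> 8 * c * \<delta> N * deg_ratio N" if i: "i \<in> {1..N}"
  proof -
    have "\<bar>t / v * real (ap3_degree N i)\<bar> \<le> t / v * real N"
      using v t ap3_degree_le[OF i] by (simp add: abs_mult mult_left_mono divide_right_mono)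
    also have "\<dots> = (4 * c * \<delta> N * deg_ratio N) * (1 / a)"
      unfolding t_def v_def threshold_def deg_ratio_def S_def[symmetric] a_def[symmetric]
      using p S a by (simp add: power2_eq_square power3_eq_cube field_simps)
    also have "\<dots> \<le> (4 * c * \<delta> N * deg_ratio N) * 2"
    proof (rule mult_left_mono)
      show "1 / a \<le> 2" using a by (simp add: field_simps)
      show "0 \<le> 4 * c * \<delta> N * deg_ratio N" using c N by (simp add: deg_ratio_def)
    qed
    finally show ?thesis by simp
  qed
qed

lemma eventually_degree_sq_pos: "\<forall>\<^sub>F N in sequentially. 0 < ap3_degree_sq N"
proof -
  have "\<forall>\<^sub>F N in sequentially. 0 < deg_ratio N"
    by (rule order_tendstoD(1)[OF deg_ratio_tendsto]) simp
  then show ?thesis by eventually_elim (auto simp: deg_ratio_def zero_less_divide_iff)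
qed

lemma deg_ratio_\<delta>_tendsto: "(\<lambda>N. 8 * c * \<delta> N * deg_ratio N) \<longlonglongrightarrow> 0"
  by (rule tendsto_eq_intros \<delta>_tendsto_0 deg_ratio_tendsto refl | simp)+

text \<open>The factor \<open>c\<close> leaves room to shift the threshold when the remainder is
  split off.\<close>

lemma ap3_linear_upper:
  assumes c: "0 < c" and e: "0 < e"
  shows "\<forall>\<^sub>F N in sequentially.
    bprob N (p N) (\<lambda>B. c * threshold N / p N ^ 2 \<le> ap3_linear N (p N) B)
      \<le> exp (- (3 / 56 * c\<^sup>2 - e) * rate N)"
proof -
  define \<epsilon> where "\<epsilon> = min 1 (e / c\<^sup>2)"
  have \<epsilon>: "0 < \<epsilon>" "\<epsilon> \<le> 1" using c e by (auto simp: \<epsilon>_def)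
  have "c\<^sup>2 * \<epsilon> \<le> e" using c by (simp add: \<epsilon>_def min_def field_simps)
  have lim: "(\<lambda>N. c\<^sup>2 * deg_ratio N * (1 - \<epsilon>) / 2) \<longlonglongrightarrow> c\<^sup>2 * (3 / 28) * (1 - \<epsilon>) / 2"
    by (intro tendsto_intros deg_ratio_tendsto) auto
  have "3 / 56 * c\<^sup>2 - e < c\<^sup>2 * (3 / 28) * (1 - \<epsilon>) / 2"
    using \<open>c\<^sup>2 * \<epsilon> \<le> e\<close> e by (simp add: algebra_simps)
  note ev = order_tendstoD(1)[OF lim this] order_tendstoD(2)[OF deg_ratio_\<delta>_tendsto[of c] \<epsilon>(1)]
  show ?thesis
    using eventually_basic eventually_degree_sq_pos eventually_rate_bounds ev
  proof eventually_elim
    case (elim N)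
    have rate: "0 \<le> rate N" using elim by (simp add: rate_def speed_def)
    define v where "v = p N * (1 - p N) * ap3_degree_sq N"
    define t where "t = c * threshold N / p N ^ 2"
    have norm: "0 < v" "0 \<le> t" "t\<^sup>2 / v = c\<^sup>2 * deg_ratio N * rate N"
      "\<And>i. i \<in> {1..N} \<Longrightarrow> \<bar>t / v * real (ap3_degree N i)\<bar> \<le> 8 * c * \<delta> N * deg_ratio N"
      unfolding v_def t_def using ap3_linear_normalization[of N c] elim c by auto
    have "bprob N (p N) (\<lambda>B. t \<le> (\<Sum>i=1..N. real (ap3_degree N i) * centered (p N) B i))
        \<le> exp (- (t\<^sup>2 / v) * (1 - \<epsilon>) / 2)"
    proof (rule linear_upper_tail)
      show "v = p N * (1 - p N) * (\<Sum>i=1..N. (real (ap3_degree N i))\<^sup>2)"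
        by (simp add: v_def ap3_degree_sq_def)
      show "\<bar>t / v * real (ap3_degree N i)\<bar> \<le> \<epsilon>" if "i \<in> {1..N}" for i
        using norm(4)[OF that] elim by simp
    qed (use elim \<epsilon> norm in auto)
    also have "- (t\<^sup>2 / v) * (1 - \<epsilon>) / 2 = - ((c\<^sup>2 * deg_ratio N * (1 - \<epsilon>) / 2) * rate N)"
      unfolding norm(3) by simp
    also have "exp \<dots> \<le> exp (- (3 / 56 * c\<^sup>2 - e) * rate N)"
      unfolding exp_le_cancel_iff mult_minus_left
      using elim rate by (intro le_imp_neg_le mult_right_mono) auto
    finally show ?case by (simp only: t_def ap3_linear_def)
  qed
qed

lemma ap3_linear_lower:
  assumes c: "0 < c" and e: "0 < e"
  shows "\<forall>\<^sub>F N in sequentially.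
    exp (- (3 / 56 * c\<^sup>2 + e) * rate N)
      \<le> bprob N (p N) (\<lambda>B. c * threshold N / p N ^ 2 \<le> ap3_linear N (p N) B)"
proof -
  \<comment> \<open>The relative loss \<open>5 * \<eta>\<close> costs 15/28 of
    \<open>c^2 * \<eta>\<close>, which stays below \<open>e\<close>.\<close>
  define \<eta> where "\<eta> = min 1 (e / c\<^sup>2)"
  have \<eta>: "0 < \<eta>" "\<eta> \<le> 1" using c e by (auto simp: \<eta>_def)
  have "c\<^sup>2 * \<eta> \<le> e" using c by (simp add: \<eta>_def min_def field_simps)
  have lim: "(\<lambda>N. c\<^sup>2 * deg_ratio N * (1 / 2 + 5 * \<eta>)) \<longlonglongrightarrow> c\<^sup>2 * (3 / 28) * (1 / 2 + 5 * \<eta>)"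
    by (intro tendsto_intros deg_ratio_tendsto)
  have "c\<^sup>2 * (3 / 28) * (1 / 2 + 5 * \<eta>) < 3 / 56 * c\<^sup>2 + e"
    using \<open>c\<^sup>2 * \<eta> \<le> e\<close> e by (simp add: algebra_simps)
  note ev = order_tendstoD(2)[OF lim this]
  \<comment> \<open>A third of the bound \<open>\<eta>^2 / 40\<close>, since the lower tail estimate
    tilts up to three times \<open>t / v\<close>.\<close>
  have "0 < \<eta>\<^sup>2 / 120" using \<eta> by simp
  note ev2 = order_tendstoD(2)[OF deg_ratio_\<delta>_tendsto[of c] this]
  have "(\<lambda>N. \<eta>\<^sup>2 * c\<^sup>2 / 4 * deg_ratio N) \<longlonglongrightarrow> \<eta>\<^sup>2 * c\<^sup>2 / 4 * (3 / 28)"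
    by (rule tendsto_mult_left[OF deg_ratio_tendsto])
  then have "filterlim (\<lambda>N. (\<eta>\<^sup>2 * c\<^sup>2 / 4 * deg_ratio N) * rate N) at_top sequentially"
    by (rule filterlim_tendsto_pos_mult_at_top[OF _ _ rate_at_top]) (use \<eta> c in simp)
  then have ev3: "\<forall>\<^sub>F N in sequentially. ln 4 \<le> (\<eta>\<^sup>2 * c\<^sup>2 / 4 * deg_ratio N) * rate N"
    by (simp add: filterlim_at_top)
  show ?thesis
    using eventually_basic eventually_degree_sq_pos ev ev2 ev3
  proof eventually_elim
    case (elim N)
    have rate: "0 \<le> rate N" using elim by (simp add: rate_def speed_def)
    define v where "v = p N * (1 - p N) * ap3_degree_sq N"
    define t where "t = c * threshold N / p N ^ 2"
    have norm: "0 < v" "0 \<le> t" "t\<^sup>2 / v = c\<^sup>2 * deg_ratio N * rate N"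
      "\<And>i. i \<in> {1..N} \<Longrightarrow> \<bar>t / v * real (ap3_degree N i)\<bar> \<le> 8 * c * \<delta> N * deg_ratio N"
      unfolding v_def t_def using ap3_linear_normalization[of N c] elim c by auto
    have "- ((3 / 56 * c\<^sup>2 + e) * rate N) \<le> - ((c\<^sup>2 * deg_ratio N * (1 / 2 + 5 * \<eta>)) * rate N)"
      using elim rate by (intro le_imp_neg_le mult_right_mono) auto
    also have "\<dots> = - (t\<^sup>2 / v) * (1 / 2 + 5 * \<eta>)" unfolding norm by simp
    finally have "exp (- (3 / 56 * c\<^sup>2 + e) * rate N) \<le> exp (- (t\<^sup>2 / v) * (1 / 2 + 5 * \<eta>))"
      by (simp only: exp_le_cancel_iff mult_minus_left)
    also have "\<dots> \<le> bprob N (p N) (\<lambda>B. t \<le> (\<Sum>i=1..N. real (ap3_degree N i) * centered (p N) B i))"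
    proof (rule linear_lower_tail)
      show "v = p N * (1 - p N) * (\<Sum>i=1..N. (real (ap3_degree N i))\<^sup>2)"
        by (simp add: v_def ap3_degree_sq_def)
      show "\<bar>3 * (t / v) * real (ap3_degree N i)\<bar> \<le> \<eta>\<^sup>2 / 40" if "i \<in> {1..N}" for i
        using norm(4)[OF that] elim by (simp add: abs_mult)
      show "ln 4 \<le> \<eta>\<^sup>2 * (t\<^sup>2 / v) / 4" using elim unfolding norm by simp
    qed (use elim \<eta> norm in auto)
    finally show ?case by (simp add: t_def ap3_linear_def)
  qed
qed

section \<open>Combining the linear part and the remainder\<close>

definition dev_prob :: "nat \<Rightarrow> real" where
  "dev_prob N = bprob N (p N) (\<lambda>B. threshold N \<le> deviation3 (ap3_hypergraph N) (p N) B)"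

text \<open>A large deviation needs either the share \<open>1 - \<rho>\<close> of the threshold from
  the linear part or the share \<rho> from the remainder.\<close>

lemma dev_prob_upper:
  assumes \<rho>: "0 < \<rho>" "\<rho> < 1"
  shows "\<forall>\<^sub>F N in sequentially. dev_prob N \<le> exp (- (3 / 56 - 3 * \<rho>) * rate N)"
proof -
  have ev: "\<forall>\<^sub>F N in sequentially. ln 2 \<le> \<rho> * rate N"
    using filterlim_tendsto_pos_mult_at_top[OF tendsto_const \<rho>(1) rate_at_top]
    by (simp add: filterlim_at_top)
  have "0 < 1 - \<rho>" using \<rho> by simp
  \<comment> \<open>Enough because \<open>a \<le> 1\<close> and
    \<open>rate N \<le> 2 * speed N\<close>.\<close>
  have K: "(0::real) < 2" by simp
  show ?thesis
    using eventually_basic eventually_rate_bounds ev ap3_linear_upper[OF \<open>0 < 1 - \<rho>\<close> \<rho>(1)]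
      remainder_negligible[OF K \<rho>(1)]
  proof eventually_elim
    case (elim N)
    define R where "R = (\<lambda>B. \<Sum>i=1..N. centered (p N) B i * ap_weight N (p N) i B)"
    have r0: "0 \<le> rate N" using elim by (simp add: rate_def speed_def)
    define a where "a = 3 / 56 * (1 - \<rho>)\<^sup>2 - \<rho>"
    have "(1 - \<rho>)\<^sup>2 \<le> 1" using \<rho> by (simp add: power_le_one)
    then have a1: "a \<le> 1" using \<rho> by (simp add: a_def)
    have "1 - 2 * \<rho> \<le> (1 - \<rho>)\<^sup>2" by (simp add: power2_eq_square algebra_simps)
    then have a2: "3 / 56 - 3 * \<rho> \<le> a - \<rho>" using \<rho> by (simp add: a_def)
    have "dev_prob N \<le> bprob N (p N) (\<lambda>B. (1 - \<rho>) * threshold N / p N ^ 2 \<le> ap3_linear N (p N) B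
        \<or> \<rho> * threshold N \<le> \<bar>R B\<bar>)"
      unfolding dev_prob_def
    proof (rule bprob_mono)
      fix B assume "threshold N \<le> deviation3 (ap3_hypergraph N) (p N) B"
      then have "threshold N \<le> p N ^ 2 * ap3_linear N (p N) B + R B"
        by (simp only: deviation3_decomposition R_def)
      then have "(1 - \<rho>) * threshold N \<le> ap3_linear N (p N) B * p N ^ 2 \<or> \<rho> * threshold N \<le> \<bar>R B\<bar>"
        by (simp add: algebra_simps) linarith
      then show "(1 - \<rho>) * threshold N / p N ^ 2 \<le> ap3_linear N (p N) B \<or> \<rho> * threshold N \<le> \<bar>R B\<bar>"
        using elim by (simp add: pos_divide_le_eq)
    qed
    also have "\<dots> \<le> exp (- a * rate N) + exp (- 2 * speed N)"
      using elim by (intro order.trans[OF bprob_disj_le] add_mono) (auto simp: R_def a_def)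
    also have "exp (- 2 * speed N) \<le> exp (- a * rate N)"
    proof -
      have "a * rate N \<le> 1 * rate N" using a1 r0 by (rule mult_right_mono)
      then show ?thesis using elim by simp
    qed
    finally have "dev_prob N \<le> 2 * exp (- a * rate N)" by simp
    also have "\<dots> = exp (ln 2 - a * rate N)" by (simp add: exp_diff exp_minus field_simps)
    also have "\<dots> \<le> exp (- (3 / 56 - 3 * \<rho>) * rate N)"
    proof -
      have "(3 / 56 - 3 * \<rho>) * rate N \<le> (a - \<rho>) * rate N" using a2 r0 by (rule mult_right_mono)
      then show ?thesis using elim by (simp add: algebra_simps)
    qed
    finally show ?case .
  qed
qed

text \<open>A linear part overshooting by the factor \<open>1 + \<rho>\<close> suffices unless the
  remainder takes the surplus back.\<close>

lemma dev_prob_lower: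
  assumes \<rho>: "0 < \<rho>" "\<rho> < 1"
  shows "\<forall>\<^sub>F N in sequentially. exp (- (3 / 56 + 3 * \<rho>) * rate N) \<le> dev_prob N"
proof -
  have ev: "\<forall>\<^sub>F N in sequentially. ln 2 \<le> \<rho> * rate N"
    using filterlim_tendsto_pos_mult_at_top[OF tendsto_const \<rho>(1) rate_at_top]
    by (simp add: filterlim_at_top)
  have ev': "\<forall>\<^sub>F N in sequentially. ln 2 \<le> rate N"
    using rate_at_top by (simp add: filterlim_at_top)
  have "0 < 1 + \<rho>" using \<rho> by simp
  \<comment> \<open>Three times \<open>rate N\<close> is at most \<open>6 * speed N\<close>: two
    units cover \<open>a \<le> 2\<close> and one covers the \<open>ln 2\<close> that halves the
    bound.\<close>
  have K: "(0::real) < 6" by simp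
  show ?thesis
    using eventually_basic eventually_rate_bounds ev ev' ap3_linear_lower[OF \<open>0 < 1 + \<rho>\<close> \<rho>(1)]
      remainder_negligible[OF K \<rho>(1)]
  proof eventually_elim
    case (elim N)
    define R where "R = (\<lambda>B. \<Sum>i=1..N. centered (p N) B i * ap_weight N (p N) i B)"
    have r0: "0 \<le> rate N" using elim by (simp add: rate_def speed_def)
    define a where "a = 3 / 56 * (1 + \<rho>)\<^sup>2 + \<rho>"
    have "\<rho> * \<rho> \<le> \<rho>" using \<rho> by (simp add: mult_left_le)
    then have "(1 + \<rho>)\<^sup>2 \<le> 1 + 3 * \<rho>" by (simp add: power2_eq_square algebra_simps)
    then have a: "a \<le> 2" "a + \<rho> \<le> 3 / 56 + 3 * \<rho>" using \<rho> by (simp_all add: a_def)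
    have "exp (- a * rate N) \<le> bprob N (p N) (\<lambda>B. (1 + \<rho>) * threshold N / p N ^ 2 \<le> ap3_linear N (p N) B)"
      using elim by (simp add: a_def)
    also have "\<dots> \<le> bprob N (p N) (\<lambda>B. threshold N \<le> deviation3 (ap3_hypergraph N) (p N) B
        \<or> \<rho> * threshold N \<le> \<bar>R B\<bar>)"
    proof (rule bprob_mono)
      fix B assume "(1 + \<rho>) * threshold N / p N ^ 2 \<le> ap3_linear N (p N) B"
      then have "(1 + \<rho>) * threshold N \<le> p N ^ 2 * ap3_linear N (p N) B"
        using elim by (simp add: pos_divide_le_eq mult.commute)
      moreover have "deviation3 (ap3_hypergraph N) (p N) B = p N ^ 2 * ap3_linear N (p N) B + R B"
        by (simp only: deviation3_decomposition R_def)
      ultimately show "threshold N \<le> deviation3 (ap3_hypergraph N) (p N) B \<or> \<rho> * threshold N \<le> \<bar>R B\<bar>"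
        by (simp add: algebra_simps) linarith
    qed
    also have "\<dots> \<le> dev_prob N + exp (- 6 * speed N)"
      unfolding dev_prob_def
      using elim by (intro order.trans[OF bprob_disj_le] add_mono) (auto simp: R_def)
    also have "exp (- 6 * speed N) \<le> exp (- a * rate N) / 2"
    proof -
      have "a * rate N \<le> 2 * rate N" using a r0 by (intro mult_right_mono)
      then have "- 6 * speed N \<le> - a * rate N - ln 2" using elim by simp
      then have "exp (- 6 * speed N) \<le> exp (- a * rate N - ln 2)" by (simp only: exp_le_cancel_iff)
      then show ?thesis by (simp add: exp_diff)
    qed
    finally have "exp (- a * rate N) / 2 \<le> dev_prob N" by simp
    moreover have "exp (- (3 / 56 + 3 * \<rho>) * rate N) \<le> exp (- a * rate N - ln 2)"
    proof -
      have "(a + \<rho>) * rate N \<le> (3 / 56 + 3 * \<rho>) * rate N" using a(2) r0 by (rule mult_right_mono)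
      then show ?thesis using elim by (simp add: algebra_simps)
    qed
    ultimately show ?case by (simp add: exp_diff)
  qed
qed

lemma rate_pos: "\<forall>\<^sub>F N in sequentially. 0 < rate N"
  using rate_at_top by (simp add: filterlim_at_top_dense)

lemma ln_dev_prob_asymp: "(\<lambda>N. - ln (dev_prob N) / rate N) \<longlonglongrightarrow> 3 / 56"
proof (rule tendstoI)
  fix e :: real assume e: "0 < e"
  define \<rho> where "\<rho> = min (1 / 2) (e / 6)"
  have \<rho>: "0 < \<rho>" "\<rho> < 1" "3 * \<rho> < e" using e by (auto simp: \<rho>_def min_def)
  show "\<forall>\<^sub>F N in sequentially. dist (- ln (dev_prob N) / rate N) (3 / 56) < e"
    using rate_pos dev_prob_upper[OF \<rho>(1,2)] dev_prob_lower[OF \<rho>(1,2)]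
  proof eventually_elim
    case (elim N)
    have pos: "0 < dev_prob N" using elim(3) exp_gt_zero less_le_trans by blast
    have "ln (dev_prob N) \<le> - (3 / 56 - 3 * \<rho>) * rate N"
      using elim(2) pos by (metis ln_exp ln_le_cancel_iff exp_gt_zero)
    moreover have "- (3 / 56 + 3 * \<rho>) * rate N \<le> ln (dev_prob N)"
      using elim(3) pos by (simp add: ln_ge_iff)
    ultimately have "(3 / 56 - 3 * \<rho>) * rate N \<le> - ln (dev_prob N)"
      "- ln (dev_prob N) \<le> (3 / 56 + 3 * \<rho>) * rate N" by linarith+
    then have "3 / 56 - 3 * \<rho> \<le> - ln (dev_prob N) / rate N"
      "- ln (dev_prob N) / rate N \<le> 3 / 56 + 3 * \<rho>"
      using elim(1) by (simp_all only: pos_le_divide_eq pos_divide_le_eq)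
    then show ?case using \<rho>(3) by (simp only: dist_real_def abs_less_iff) linarith
  qed
qed

lemma dev_prob_pos: "\<forall>\<^sub>F N in sequentially. 0 < dev_prob N"
  using dev_prob_lower[of "1 / 2", simplified]
  by eventually_elim (meson exp_gt_zero less_le_trans)

lemma dev_prob_exponent:
  "\<exists>\<epsilon> :: nat \<Rightarrow> real. \<epsilon> \<longlonglongrightarrow> 0 \<and>
    (\<forall>\<^sub>F N in sequentially. dev_prob N = exp (- (3 + \<epsilon> N) * \<delta> N ^ 2 * p N * real N / (56 * (1 - p N))))"
proof (intro exI conjI)
  \<comment> \<open>The claimed identity solved for \<epsilon>; it holds once the rate and the
    probability are positive.\<close>
  define \<epsilon> where "\<epsilon> = (\<lambda>N. 56 * (- ln (dev_prob N) / rate N) - 3)"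
  have "\<epsilon> \<longlonglongrightarrow> 56 * (3 / 56) - 3"
    unfolding \<epsilon>_def by (intro tendsto_intros ln_dev_prob_asymp)
  then show "\<epsilon> \<longlonglongrightarrow> 0" by simp
  show "\<forall>\<^sub>F N in sequentially. dev_prob N = exp (- (3 + \<epsilon> N) * \<delta> N ^ 2 * p N * real N / (56 * (1 - p N)))"
    using rate_pos dev_prob_pos
  proof eventually_elim
    case (elim N)
    have "- (3 + \<epsilon> N) * \<delta> N ^ 2 * p N * real N / (56 * (1 - p N)) = - (3 + \<epsilon> N) / 56 * rate N"
      by (simp add: rate_def speed_def)
    also have "\<dots> = ln (dev_prob N)" using elim(1) by (simp add: \<epsilon>_def)
    finally show ?case using elim(2) by simp
  qed
qed

end

theorem corollary1p3:
  fixes p \<delta> :: "nat \<Rightarrow> real"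
  assumes p_range: "\<And>N. N \<ge> 1 \<Longrightarrow> 0 < p N \<and> p N < 1 / 2"
    and p_const_or_null: "(\<exists>c. \<forall>N\<ge>1. p N = c) \<or> p \<longlonglongrightarrow> 0"
    and \<delta>_pos: "\<forall>\<^sub>F N in sequentially. \<delta> N > 0"
    and \<delta>_lower: "(\<lambda>N. sqrt (ln (real N) / (p N * real N)) / \<delta> N) \<longlonglongrightarrow> 0"
    and \<delta>_upper: "(\<lambda>N. \<delta> N / sqrt (p N)) \<longlonglongrightarrow> 0"
  shows "\<exists>\<epsilon> :: nat \<Rightarrow> real. \<epsilon> \<longlonglongrightarrow> 0 \<and>
    (\<forall>\<^sub>F N in sequentially.
       measure_pmf.prob (binomial_subset_pmf N (p N))
         {B. deviation3 (ap3_hypergraph N) (p N) B \<ge> \<delta> N * p N ^ 3 * real N ^ 2 / 4}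
       = exp (- (3 + \<epsilon> N) * \<delta> N ^ 2 * p N * real N / (56 * (1 - p N))))"
proof -
  interpret moderate_deviation p \<delta>
    by unfold_locales (use p_range \<delta>_pos \<delta>_lower \<delta>_upper in auto)
  show ?thesis
    using dev_prob_exponent unfolding dev_prob_def threshold_def .
qed

end
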